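(* Let $X$ be a full $d$-dimensional shift on a finite alphabet and $\Phi=(\Phi_{\Lambda})_{\Lambda\Subset \mathbb Z^d}$ be an interaction. If $\sum_{\Lambda\Subset \mathbb Z^d,\,\Lambda\ni 0}\|\Phi_\Lambda\|_\infty<\infty$ then $\Phi$ cannot have a freezing phase transition.
   Context: $X=\mathcal A^{\mathbb Z^d}$ with $\mathcal A$ finite and the shift action. A (shift-invariant) interaction $\Phi$ is a family of functions $\Phi_\Lambda:X\to\mathbb R$ indexed by finite subsets $\Lambda\Subset\mathbb Z^d$, each $\Phi_\Lambda$ depending only on $x|_\Lambda$. Its associated potential is $\phi=\sum_{\Lambda\Subset\mathbb Z^d,\,0\in\Lambda}\Phi_\Lambda/|\Lambda|$. $\Phi$ has a freezing phase transition if $\phi$ does, i.e. there is $\beta_c$ with $\mathrm{ES}(\beta\phi)=\mathrm{ES}(\beta'\phi)$ for all $\beta,\beta'>\beta_c$ while $\mathrm{ES}(\beta\phi)\ne\mathrm{ES}(\beta'\phi)$ for any $\beta<\beta_c<\beta'$, where $\mathrm{ES}(\beta\phi)$ is the set of shift-invariant probability measures $\mu$ maximizing $h(\mu)+\beta\int\phi\,d\mu$ ($h$ = measure-theoretic entropy). *)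

theory Defs
  imports "HOL-Probability.Probability"
begin

text \<open>Sites of Z^d are functions 'd \<Rightarrow> int with 'd a finite type (d = CARD('d));
  configurations of the full shift X = A^(Z^d) are functions from sites to the finite alphabet 'a.\<close>

definition site_add :: "('d \<Rightarrow> int) \<Rightarrow> ('d \<Rightarrow> int) \<Rightarrow> ('d \<Rightarrow> int)" where
  "site_add m n = (\<lambda>i. m i + n i)"

definition origin :: "'d \<Rightarrow> int" where
  "origin = (\<lambda>_. 0)"

definition shift :: "('d \<Rightarrow> int) \<Rightarrow> (('d \<Rightarrow> int) \<Rightarrow> 'a) \<Rightarrow> (('d \<Rightarrow> int) \<Rightarrow> 'a)" where
  "shift n x = (\<lambda>m. x (site_add m n))"

definition full_shift_space :: "(('d \<Rightarrow> int) \<Rightarrow> 'a) measure" where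
  "full_shift_space = PiM UNIV (\<lambda>_. count_space UNIV)"

definition invariant_measures :: "(('d::finite \<Rightarrow> int) \<Rightarrow> 'a::finite) measure set" where
  "invariant_measures = {\<mu>. sets \<mu> = sets full_shift_space \<and> prob_space \<mu> \<and>
      (\<forall>n. distr \<mu> \<mu> (shift n) = \<mu>)}"

definition box :: "nat \<Rightarrow> ('d::finite \<Rightarrow> int) set" where
  "box n = {m. \<forall>i. 0 \<le> m i \<and> m i < int n}"

definition cylinder :: "('d \<Rightarrow> int) set \<Rightarrow> (('d \<Rightarrow> int) \<Rightarrow> 'a) \<Rightarrow> (('d \<Rightarrow> int) \<Rightarrow> 'a) set" where
  "cylinder \<Lambda> w = {x. \<forall>m\<in>\<Lambda>. x m = w m}"

definition block_entropy :: "(('d \<Rightarrow> int) \<Rightarrow> 'a::finite) measure \<Rightarrow> ('d \<Rightarrow> int) set \<Rightarrow> real" where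
  "block_entropy \<mu> \<Lambda> = (\<Sum>w\<in>PiE \<Lambda> (\<lambda>_. UNIV).
      (let p = measure \<mu> (cylinder \<Lambda> w) in if p = 0 then 0 else - (p * ln p)))"

text \<open>Measure-theoretic (Kolmogorov-Sinai) entropy of \<mu> for the Z^d shift action,
  computed with the generating partition into one-site cylinders, along cubes [0,n)^d.\<close>
definition ms_entropy :: "(('d::finite \<Rightarrow> int) \<Rightarrow> 'a::finite) measure \<Rightarrow> real" where
  "ms_entropy \<mu> = lim (\<lambda>n. block_entropy \<mu> (box n) / real (card (box n :: ('d \<Rightarrow> int) set)))"

definition is_interaction :: "(('d \<Rightarrow> int) set \<Rightarrow> (('d \<Rightarrow> int) \<Rightarrow> 'a) \<Rightarrow> real) \<Rightarrow> bool" where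
  "is_interaction \<Phi> \<longleftrightarrow>
     (\<forall>\<Lambda> x y. finite \<Lambda> \<longrightarrow> (\<forall>m\<in>\<Lambda>. x m = y m) \<longrightarrow> \<Phi> \<Lambda> x = \<Phi> \<Lambda> y) \<and>
     (\<forall>\<Lambda> n x. finite \<Lambda> \<longrightarrow> \<Phi> ((\<lambda>m. site_add m n) ` \<Lambda>) x = \<Phi> \<Lambda> (shift n x))"

definition sup_norm :: "('b \<Rightarrow> real) \<Rightarrow> real" where
  "sup_norm f = (SUP x. \<bar>f x\<bar>)"

definition potential :: "(('d \<Rightarrow> int) set \<Rightarrow> (('d \<Rightarrow> int) \<Rightarrow> 'a) \<Rightarrow> real) \<Rightarrow> (('d \<Rightarrow> int) \<Rightarrow> 'a) \<Rightarrow> real" where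
  "potential \<Phi> x = (\<Sum>\<^sub>\<infinity>\<Lambda>\<in>{\<Lambda>. finite \<Lambda> \<and> origin \<in> \<Lambda>}. \<Phi> \<Lambda> x / real (card \<Lambda>))"

definition equilibrium_states :: "((('d::finite \<Rightarrow> int) \<Rightarrow> 'a::finite) \<Rightarrow> real) \<Rightarrow> (('d \<Rightarrow> int) \<Rightarrow> 'a) measure set" where
  "equilibrium_states \<phi> = {\<mu> \<in> invariant_measures. \<forall>\<nu>\<in>invariant_measures.
      ms_entropy \<nu> + integral\<^sup>L \<nu> \<phi> \<le> ms_entropy \<mu> + integral\<^sup>L \<mu> \<phi>}"

definition freezing_phase_transition :: "((('d::finite \<Rightarrow> int) \<Rightarrow> 'a::finite) \<Rightarrow> real) \<Rightarrow> bool" where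
  "freezing_phase_transition \<phi> \<longleftrightarrow> (\<exists>\<beta>c::real.
     (\<forall>\<beta> \<beta>'. \<beta> > \<beta>c \<longrightarrow> \<beta>' > \<beta>c \<longrightarrow>
        equilibrium_states (\<lambda>x. \<beta> * \<phi> x) = equilibrium_states (\<lambda>x. \<beta>' * \<phi> x)) \<and>
     (\<forall>\<beta> \<beta>'. \<beta> < \<beta>c \<longrightarrow> \<beta>c < \<beta>' \<longrightarrow>
        equilibrium_states (\<lambda>x. \<beta> * \<phi> x) \<noteq> equilibrium_states (\<lambda>x. \<beta>' * \<phi> x)))"

end

theory Submission
  imports Defs
begin

text \<open>Let \<open>U\<close> denote the sum of the interaction over the nonempty subsets of a box and \<open>Z\<close> the partition
  function of \<open>\<beta> U\<close>. Shift averages of finite-volume Gibbs measures have an invariant limit point whose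
  free energy is at least the limit of \<open>ln Z\<close> per site; so equilibrium states exist, and an equilibrium
  state cannot be beaten by \<open>ln Z\<close> in the limit of large boxes.

  Freezing yields a measure \<open>\<mu>\<close> that is an equilibrium state for all large \<open>\<beta>\<close>. If some pattern \<open>v\<close> had
  \<open>\<mu>\<close>-measure zero, one could replace any set of occurrences of a pattern \<open>u\<close> of positive measure by
  \<open>v\<close>. Each replacement costs a bounded amount of energy, by the summability of the norms, and the
  result determines the original; this multiplies \<open>Z\<close> by a factor exponential in the volume, a
  contradiction. So \<open>\<mu>\<close> has full support. Letting \<open>\<beta>\<close> tend to infinity, replacing all occurrences of
  \<open>u\<close> by \<open>v\<close> shows that \<open>U(v) - U(u)\<close> is at most a boundary term, for all \<open>u\<close> and \<open>v\<close>. Hence the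
  integral of the potential is the same for all invariant measures, and the equilibrium states do not
  depend on \<open>\<beta>\<close> at all.\<close>

section \<open>Block entropies\<close>

text \<open>Two lower bounds on \<open>ln Z\<close> do the work, both with the window side
  \<open>n\<close> fixed while the number of windows grows. The marked one adds
  \<open>ln (1 + exp (\<beta> * energy_gain n u v))\<close> per occurrence of \<open>u\<close>; this
  is positive whatever the sign of the gain, so full support follows however costly \<open>v\<close>
  is. The unmarked one gives up the entropy of \<open>\<mu>\<close>, which remains as an error.
  Since one and the same \<open>\<mu>\<close> serves all large \<open>\<beta>\<close>, that error
  stays fixed while the gain, weighted by the positive measure of \<open>u\<close>, is multiplied by
  \<open>\<beta>\<close>. Only afterwards does \<open>n\<close> grow, and the boundary term vanishes
  per site. Limits of entropies are controlled because \<open>ms_entropy\<close> is an infimum of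
  block densities, each continuous under convergence on cylinders. The definition of freezing allows
  a negative \<open>\<beta>c\<close>, so existence of equilibrium states is proved for all real
  \<open>\<beta>\<close>, whereas the replacement estimates assume
  \<open>\<beta> \<ge> 0\<close>.\<close>

definition depends_on :: "'i set \<Rightarrow> (('i \<Rightarrow> 'a) \<Rightarrow> 'b) \<Rightarrow> bool" where
  "depends_on J f \<longleftrightarrow> (\<forall>x y. (\<forall>m\<in>J. x m = y m) \<longrightarrow> f x = f y)"

abbreviation blocks :: "'i set \<Rightarrow> ('i \<Rightarrow> 'a) set" where
  "blocks J \<equiv> PiE J (\<lambda>_. UNIV)"

text \<open>Makes a block entropy the expectation of a function of finitely many coordinates. On
  null cylinders the value is \<open>- ln 0 = 0\<close>, and its weight vanishes anyway.\<close>

definition information :: "(('d \<Rightarrow> int) \<Rightarrow> 'a) measure \<Rightarrow> ('d \<Rightarrow> int) set \<Rightarrow> (('d \<Rightarrow> int) \<Rightarrow> 'a) \<Rightarrow> real" where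
  "information M J x = - ln (measure M (cylinder J x))"

lemma depends_onD: "depends_on J f \<Longrightarrow> (\<And>m. m \<in> J \<Longrightarrow> x m = y m) \<Longrightarrow> f x = f y"
  by (auto simp: depends_on_def)

lemma depends_on_mono: "depends_on J f \<Longrightarrow> J \<subseteq> K \<Longrightarrow> depends_on K f"
  by (auto simp: depends_on_def subset_iff)

lemma finite_blocks [simp]: "finite J \<Longrightarrow> finite (blocks J :: ('i \<Rightarrow> 'a::finite) set)"
  by (rule finite_PiE) auto

lemma cylinder_cong: "(\<And>m. m \<in> J \<Longrightarrow> x m = y m) \<Longrightarrow> cylinder J x = cylinder J y"
  by (auto simp: cylinder_def)

lemma cylinder_restrict [simp]: "cylinder J (restrict x J) = cylinder J x"
  by (auto simp: cylinder_def)

lemma cylinder_antimono: "J \<subseteq> K \<Longrightarrow> cylinder K x \<subseteq> cylinder J x"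
  by (auto simp: cylinder_def)

lemma mem_cylinder_iff: "w \<in> blocks J \<Longrightarrow> x \<in> cylinder J w \<longleftrightarrow> w = restrict x J"
  by (auto simp: cylinder_def fun_eq_iff PiE_def extensional_def restrict_def)

lemma depends_on_information: "depends_on J (information M J)"
  unfolding depends_on_def information_def using cylinder_cong by metis

lemma depends_on_comp: "depends_on J f \<Longrightarrow> depends_on J (\<lambda>x. g (f x))"
  unfolding depends_on_def by metis

lemma depends_on_comp2: "depends_on J f \<Longrightarrow> depends_on K g \<Longrightarrow> depends_on (J \<union> K) (\<lambda>x. h (f x) (g x))"
  unfolding depends_on_def by (metis UnCI)

section \<open>Gibbs' inequality and concavity of entropy\<close>

lemma ln_le_zero_of_le_one: "0 \<le> x \<Longrightarrow> x \<le> 1 \<Longrightarrow> ln x \<le> (0::real)"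
  by (cases "x = 0") auto

lemma block_entropy_eq_sum_information:
  "block_entropy M J = (\<Sum>w\<in>blocks J. measure M (cylinder J w) * information M J w)"
  unfolding block_entropy_def information_def by (intro sum.cong) (auto simp: Let_def)

text \<open>The finite variational principle: \<open>ln t \<le> t - 1\<close> at
  \<open>t = exp (r i) / (Z * p i)\<close>, weighted by \<open>p i\<close> and summed. It serves
  both to bound free energies by partition functions and, with \<open>r\<close> the logarithm of
  another distribution, to obtain subadditivity of entropy.\<close>

lemma gibbs_inequality:
  fixes p r :: "'i \<Rightarrow> real"
  assumes "finite I" and p: "\<And>i. i \<in> I \<Longrightarrow> 0 \<le> p i" and sum1: "sum p I = 1"
  shows "(\<Sum>i\<in>I. - (p i * ln (p i))) + (\<Sum>i\<in>I. p i * r i) \<le> ln (\<Sum>i\<in>I. exp (r i))"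
proof -
  define Z where "Z = (\<Sum>i\<in>I. exp (r i))"
  have "I \<noteq> {}" using sum1 by auto
  then have Z: "Z > 0" unfolding Z_def using \<open>finite I\<close> by (intro sum_pos) auto
  have "- (p i * ln (p i)) + p i * r i - p i * ln Z \<le> exp (r i) / Z - p i" if "i \<in> I" for i
  proof (cases "p i = 0")
    case True
    then show ?thesis using Z by simp
  next
    case False
    with p[OF that] have pos: "p i > 0" by simp
    have "ln (exp (r i) / (Z * p i)) \<le> exp (r i) / (Z * p i) - 1"
      by (rule ln_le_minus_one) (use Z pos in auto)
    moreover have "ln (exp (r i) / (Z * p i)) = r i - ln Z - ln (p i)"
      using Z pos by (simp add: ln_div ln_mult)
    ultimately have "p i * (r i - ln Z - ln (p i)) \<le> p i * (exp (r i) / (Z * p i) - 1)"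
      using pos by simp
    then show ?thesis using pos Z by (simp add: algebra_simps)
  qed
  then have "(\<Sum>i\<in>I. - (p i * ln (p i)) + p i * r i - p i * ln Z) \<le> (\<Sum>i\<in>I. exp (r i) / Z - p i)"
    by (rule sum_mono)
  also have "\<dots> = 0"
    using Z sum1 by (simp add: sum_subtractf sum_divide_distrib[symmetric] Z_def)
  finally have "(\<Sum>i\<in>I. - (p i * ln (p i))) + (\<Sum>i\<in>I. p i * r i) - sum p I * ln Z \<le> 0"
    by (simp only: sum_subtractf sum.distrib sum_distrib_right)
  then show ?thesis using sum1 by (simp add: Z_def)
qed

text \<open>Jensen for \<open>- (t * ln t)\<close>: the graph lies below its tangent at the mean
  \<open>y\<close>, and the linear terms cancel after averaging. The case \<open>y = 0\<close> is
  separate because the tangent is vertical there.\<close>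

lemma entropy_concave:
  fixes p :: "'i \<Rightarrow> real"
  assumes "finite I" and a: "\<And>i. i \<in> I \<Longrightarrow> 0 \<le> a i" and suma: "sum a I = 1"
    and p: "\<And>i. i \<in> I \<Longrightarrow> 0 \<le> p i" and y: "y = (\<Sum>i\<in>I. a i * p i)"
  shows "(\<Sum>i\<in>I. a i * - (p i * ln (p i))) \<le> - (y * ln y)"
proof (cases "y = 0")
  case True
  then have "\<forall>i\<in>I. a i * p i = 0"
    using sum_nonneg_eq_0_iff[OF \<open>finite I\<close>, of "\<lambda>i. a i * p i"] a p y by auto
  then have "(\<Sum>i\<in>I. a i * - (p i * ln (p i))) = 0"
    by (intro sum.neutral) (auto simp: mult.assoc[symmetric])
  then show ?thesis using True by simp
next
  case False
  have "y \<ge> 0" unfolding y using a p by (intro sum_nonneg) auto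
  with False have ypos: "y > 0" by simp
  have "a i * - (p i * ln (p i)) \<le> a i * (- (p i * ln y) + y - p i)" if "i \<in> I" for i
  proof (rule mult_left_mono)
    show "- (p i * ln (p i)) \<le> - (p i * ln y) + y - p i"
    proof (cases "p i = 0")
      case True then show ?thesis using ypos by simp
    next
      case False
      with p[OF that] have pos: "p i > 0" by simp
      have "ln (y / p i) \<le> y / p i - 1" by (rule ln_le_minus_one) (use ypos pos in auto)
      then have "p i * (ln y - ln (p i)) \<le> p i * (y / p i - 1)" using pos ypos by (simp add: ln_div)
      then show ?thesis using pos by (simp add: algebra_simps)
    qed
  qed (use a that in auto)
  then have "(\<Sum>i\<in>I. a i * - (p i * ln (p i))) \<le> (\<Sum>i\<in>I. a i * (- (p i * ln y) + y - p i))"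
    by (rule sum_mono)
  also have "\<dots> = (\<Sum>i\<in>I. - (a i * p i) * ln y) + (\<Sum>i\<in>I. a i) * y - (\<Sum>i\<in>I. a i * p i)"
    by (simp add: algebra_simps sum.distrib sum_subtractf sum_distrib_right sum_distrib_left sum_negf)
  also have "(\<Sum>i\<in>I. - (a i * p i) * ln y) = - (y * ln y)"
    unfolding y sum_distrib_right[symmetric] sum_negf by simp
  finally show ?thesis using suma y by simp
qed

lemma local_eq_UN_cylinders:
  assumes "depends_on J (\<lambda>x. x \<in> A)"
  shows "A = (\<Union>w\<in>{w\<in>blocks J. w \<in> A}. cylinder J w)"
proof (intro equalityI subsetI)
  fix x assume "x \<in> A"
  then have "restrict x J \<in> A" using depends_onD[OF assms, of x "restrict x J"] by simp
  then show "x \<in> (\<Union>w\<in>{w\<in>blocks J. w \<in> A}. cylinder J w)"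
    by (intro UN_I[of "restrict x J"]) (auto simp: cylinder_def)
next
  fix x assume "x \<in> (\<Union>w\<in>{w\<in>blocks J. w \<in> A}. cylinder J w)"
  then obtain w where "w \<in> A" "x \<in> cylinder J w" by auto
  then show "x \<in> A" using depends_onD[OF assms, of x w] by (auto simp: cylinder_def)
qed

text \<open>Two kinds of measures are to be treated alike: invariant measures on the product
  sigma-algebra, and pmfs, for which every set is measurable. Measurable cylinders are what
  finite-block computations take from both.\<close>

locale config_prob = prob_space M for M :: "(('d::finite \<Rightarrow> int) \<Rightarrow> 'a::finite) measure" +
  assumes space_UNIV: "space M = UNIV"
    and cylinder_sets: "finite J \<Longrightarrow> cylinder J w \<in> sets M"
begin

lemma local_eq_sum_cylinders:
  fixes f :: "(('d \<Rightarrow> int) \<Rightarrow> 'a) \<Rightarrow> real"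
  assumes "finite J" "depends_on J f"
  shows "f = (\<lambda>x. \<Sum>w\<in>blocks J. f w * indicator (cylinder J w) x)"
proof
  fix x
  have "(\<Sum>w\<in>blocks J. f w * indicator (cylinder J w) x) = (\<Sum>w\<in>blocks J. if w = restrict x J then f w else 0)"
    by (intro sum.cong refl) (simp add: indicator_def mem_cylinder_iff)
  also have "\<dots> = f (restrict x J)" using \<open>finite J\<close> by (simp add: sum.delta)
  also have "\<dots> = f x" using assms(2) by (rule depends_onD) simp
  finally show "f x = (\<Sum>w\<in>blocks J. f w * indicator (cylinder J w) x)" by simp
qed

lemma
  fixes f :: "(('d \<Rightarrow> int) \<Rightarrow> 'a) \<Rightarrow> real"
  assumes "finite J" "depends_on J f"
  shows integrable_local: "integrable M f"
    and expectation_local: "expectation f = (\<Sum>w\<in>blocks J. prob (cylinder J w) * f w)"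
proof -
  have i: "integrable M (\<lambda>x. f w * indicator (cylinder J w) x)" for w
    using cylinder_sets[OF \<open>finite J\<close>] by (intro integrable_mult_right) (simp add: emeasure_eq_measure)
  show "integrable M f"
    by (subst local_eq_sum_cylinders[OF assms]) (intro Bochner_Integration.integrable_sum i)
  show "expectation f = (\<Sum>w\<in>blocks J. prob (cylinder J w) * f w)"
    using i cylinder_sets[OF \<open>finite J\<close>]
    by (subst local_eq_sum_cylinders[OF assms]) (simp add: space_UNIV mult.commute)
qed

lemma sum_prob_cylinders:
  assumes "finite J" shows "(\<Sum>w\<in>blocks J. prob (cylinder J w)) = 1"
  using expectation_local[OF assms, of "\<lambda>_. 1"] prob_space by (simp add: depends_on_def)

lemma block_entropy_eq_expectation:
  "finite J \<Longrightarrow> block_entropy M J = expectation (information M J)"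
  by (simp add: expectation_local[OF _ depends_on_information] block_entropy_eq_sum_information)

lemma block_entropy_gibbs:
  assumes "finite J" "depends_on J r"
  shows "block_entropy M J + expectation r \<le> ln (\<Sum>w\<in>blocks J. exp (r w))"
proof -
  have "block_entropy M J = (\<Sum>w\<in>blocks J. - (prob (cylinder J w) * ln (prob (cylinder J w))))"
    unfolding block_entropy_eq_sum_information information_def by simp
  then show ?thesis
    using gibbs_inequality[of "blocks J" "\<lambda>w. prob (cylinder J w)" r] assms
    by (simp add: sum_prob_cylinders expectation_local)
qed

lemma block_entropy_nonneg: "0 \<le> block_entropy M J"
  unfolding block_entropy_eq_sum_information information_def
  by (intro sum_nonneg mult_nonneg_nonneg) (auto simp: measure_nonneg ln_le_zero_of_le_one)

lemma block_entropy_le_card: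
  assumes "finite J" shows "block_entropy M J \<le> card J * ln CARD('a)"
  using block_entropy_gibbs[OF assms, of "\<lambda>_. 0"]
  by (simp add: depends_on_def card_PiE assms ln_realpow)

text \<open>A larger window has smaller cylinders, so the information grows pointwise; on null
  cylinders, where \<open>ln 0 = 0\<close> would spoil this, the weight is zero.\<close>

lemma block_entropy_mono:
  assumes "finite K" "J \<subseteq> K" shows "block_entropy M J \<le> block_entropy M K"
proof -
  have J: "finite J" using assms finite_subset by blast
  have "block_entropy M J = (\<Sum>w\<in>blocks K. prob (cylinder K w) * information M J w)"
    using block_entropy_eq_expectation[OF J]
      expectation_local[OF assms(1) depends_on_mono[OF depends_on_information assms(2)]] by simp
  also have "\<dots> \<le> (\<Sum>w\<in>blocks K. prob (cylinder K w) * information M K w)"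
  proof (rule sum_mono)
    fix w
    have "prob (cylinder K w) \<le> prob (cylinder J w)"
      by (rule finite_measure_mono[OF cylinder_antimono[OF assms(2)] cylinder_sets[OF J]])
    moreover have "prob (cylinder K w) = 0 \<or> prob (cylinder K w) > 0"
      using measure_nonneg[of M "cylinder K w"] by linarith
    ultimately show "prob (cylinder K w) * information M J w \<le> prob (cylinder K w) * information M K w"
      by (auto simp: information_def)
  qed
  also have "\<dots> = block_entropy M K" by (simp add: block_entropy_eq_sum_information)
  finally show ?thesis .
qed

text \<open>Used with the two marginals as \<open>f\<close> and \<open>g\<close>: their product has
  total mass one.\<close>

lemma sum_blocks_Un:
  fixes f g :: "(('d \<Rightarrow> int) \<Rightarrow> 'a) \<Rightarrow> real"
  assumes "A \<inter> B = {}" "depends_on A f" "depends_on B g"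
  shows "(\<Sum>w\<in>blocks (A \<union> B). f w * g w) = sum f (blocks A) * sum g (blocks B)"
proof -
  have "sum f (blocks A) * sum g (blocks B) = (\<Sum>(a, b)\<in>blocks A \<times> blocks B. f a * g b)"
    by (simp add: sum_product sum.cartesian_product)
  also have "\<dots> = (\<Sum>w\<in>blocks (A \<union> B). f w * g w)"
  proof (rule sum.reindex_bij_witness[where i = "\<lambda>w. (restrict w A, restrict w B)" and j = "\<lambda>(a, b). merge A B (a, b)"], goal_cases)
    case (1 ab) then show ?case using assms(1)
      by (auto simp: PiE_restrict)
  next
    case (5 ab)
    then obtain a b where ab: "ab = (a, b)" by force
    have "f (merge A B (a, b)) = f a"
      by (rule depends_onD[OF assms(2)]) (simp add: merge_def)
    moreover have "g (merge A B (a, b)) = g b"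
      by (rule depends_onD[OF assms(3)]) (use assms(1) in \<open>auto simp: merge_def\<close>)
    ultimately show ?case by (simp add: ab)
  qed (auto simp: merge_def fun_eq_iff PiE_def extensional_def restrict_def)
  finally show ?thesis by simp
qed

text \<open>Relative entropy with respect to the product of the marginals is nonnegative. For
  overlapping windows \<open>B\<close> is replaced by \<open>B - A\<close>, whose block entropy is
  no larger.\<close>

lemma block_entropy_subadditive:
  assumes "finite A" "finite B"
  shows "block_entropy M (A \<union> B) \<le> block_entropy M A + block_entropy M B"
proof -
  have disj: "block_entropy M (A \<union> B) \<le> block_entropy M A + block_entropy M B"
    if fin: "finite A" "finite B" and dj: "A \<inter> B = {}" for A B
  proof -
    let ?C = "A \<union> B"
    define q where "q w = prob (cylinder A w) * prob (cylinder B w)" for w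
    \<comment> \<open>On blocks of positive measure both marginals are positive, so
      \<open>ln (q w)\<close> splits into a sum of logarithms and \<open>exp\<close> undoes
      it.\<close>
    define I where "I = {w \<in> blocks ?C. prob (cylinder ?C w) \<noteq> 0}"
    have finI: "finite I" and IC: "I \<subseteq> blocks ?C" using fin by (auto simp: I_def)
    have dq: "depends_on A (\<lambda>w. prob (cylinder A w))" "depends_on B (\<lambda>w. prob (cylinder B w))"
      using cylinder_cong unfolding depends_on_def by metis+
    have qpos: "prob (cylinder A w) > 0" "prob (cylinder B w) > 0" if "w \<in> I" for w
    proof -
      have "prob (cylinder ?C w) > 0" using that by (auto simp: I_def less_le measure_nonneg)
      moreover have "prob (cylinder ?C w) \<le> prob (cylinder A w)" "prob (cylinder ?C w) \<le> prob (cylinder B w)"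
        using cylinder_sets fin by (auto intro!: finite_measure_mono cylinder_antimono)
      ultimately show "prob (cylinder A w) > 0" "prob (cylinder B w) > 0" by auto
    qed
    have sumI: "(\<Sum>w\<in>I. prob (cylinder ?C w) * h w) = (\<Sum>w\<in>blocks ?C. prob (cylinder ?C w) * h w)" for h
      using fin by (intro sum.mono_neutral_left) (auto simp: I_def)
    have sum1: "(\<Sum>w\<in>I. prob (cylinder ?C w)) = 1"
      using sumI[of "\<lambda>_. 1"] sum_prob_cylinders[of ?C] fin by simp
    have "(\<Sum>w\<in>I. - (prob (cylinder ?C w) * ln (prob (cylinder ?C w)))) + (\<Sum>w\<in>I. prob (cylinder ?C w) * ln (q w))
       \<le> ln (\<Sum>w\<in>I. exp (ln (q w)))"
      by (rule gibbs_inequality[OF finI _ sum1]) simp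
    also have "(\<Sum>w\<in>I. exp (ln (q w))) = sum q I"
      by (intro sum.cong refl exp_ln) (auto simp: q_def qpos)
    also have "ln (sum q I) \<le> 0"
    proof -
      have "sum q I \<le> sum q (blocks ?C)"
        using fin IC by (intro sum_mono2) (auto simp: q_def)
      also have "\<dots> = 1"
        unfolding q_def sum_blocks_Un[OF dj dq] using fin by (simp add: sum_prob_cylinders)
      finally show ?thesis
        by (intro ln_le_zero_of_le_one) (auto simp: sum_nonneg q_def)
    qed
    also have "(\<Sum>w\<in>I. - (prob (cylinder ?C w) * ln (prob (cylinder ?C w)))) = block_entropy M ?C"
      using sumI[of "\<lambda>w. - ln (prob (cylinder ?C w))"]
      by (simp add: block_entropy_eq_sum_information information_def)
    also have "(\<Sum>w\<in>I. prob (cylinder ?C w) * ln (q w))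
      = (\<Sum>w\<in>I. prob (cylinder ?C w) * (- information M A w - information M B w))"
      by (intro sum.cong refl) (simp add: q_def ln_mult_pos qpos information_def)
    also have "\<dots> = expectation (\<lambda>w. - information M A w - information M B w)"
      unfolding sumI using fin depends_on_comp2[OF depends_on_information depends_on_information]
      by (intro expectation_local[symmetric]) auto
    also have "\<dots> = - block_entropy M A - block_entropy M B"
      using fin by (simp add: block_entropy_eq_expectation integrable_local[OF _ depends_on_information])
    finally show ?thesis by simp
  qed
  have "block_entropy M (A \<union> (B - A)) \<le> block_entropy M A + block_entropy M (B - A)"
    using assms by (intro disj) auto
  also have "block_entropy M (B - A) \<le> block_entropy M B"
    using assms by (intro block_entropy_mono) auto
  finally show ?thesis by simp
qed

lemma block_entropy_UN:
  assumes "finite I" "\<And>i. i \<in> I \<Longrightarrow> finite (A i)"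
  shows "block_entropy M (\<Union>i\<in>I. A i) \<le> (\<Sum>i\<in>I. block_entropy M (A i))"
  using assms
proof (induction I)
  case empty
  then show ?case using block_entropy_le_card[of "{}"] by simp
next
  case (insert i I)
  have "block_entropy M (A i \<union> (\<Union>i\<in>I. A i)) \<le> block_entropy M (A i) + block_entropy M (\<Union>i\<in>I. A i)"
    using insert by (intro block_entropy_subadditive) auto
  then show ?case using insert by simp
qed

end

section \<open>Boxes and the entropy density\<close>

abbreviation translate :: "('d \<Rightarrow> int) \<Rightarrow> ('d \<Rightarrow> int) set \<Rightarrow> ('d \<Rightarrow> int) set" where
  "translate t J \<equiv> (\<lambda>m. site_add m t) ` J"

definition margin :: "nat \<Rightarrow> nat \<Rightarrow> ('d::finite \<Rightarrow> int) set" where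
  "margin n k = {y \<in> box n. \<exists>i. y i < int k \<or> int n - int k \<le> y i}"

definition site_neg :: "('d \<Rightarrow> int) \<Rightarrow> ('d \<Rightarrow> int)" where
  "site_neg t = (\<lambda>i. - t i)"

lemma site_add_neg [simp]:
  "site_add (site_add m t) (site_neg t) = m" "site_add (site_add m (site_neg t)) t = m"
  by (auto simp: site_add_def site_neg_def)

lemma site_add_origin [simp]: "site_add m origin = m" "site_add origin m = m"
  by (auto simp: site_add_def origin_def)

lemma site_neg_neg [simp]: "site_neg (site_neg t) = t"
  by (simp add: site_neg_def)

lemma site_add_self_neg [simp]: "site_add t (site_neg t) = origin"
  by (simp add: site_neg_def site_add_def origin_def)

lemma shift_shift: "shift s (shift t x) = shift (site_add s t) x"
  by (simp add: shift_def site_add_def add.assoc)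

lemma shift_neg [simp]: "shift t (shift (site_neg t) x) = x" "shift (site_neg t) (shift t x) = x"
  by (simp_all add: shift_def)

lemma inj_site_add [simp]: "inj_on (\<lambda>m. site_add m t) A"
  by (rule inj_on_inverseI[where g = "\<lambda>m. site_add m (site_neg t)"]) simp

lemma translate_neg [simp]:
  "translate (site_neg t) (translate t J) = J" "translate t (translate (site_neg t) J) = J"
  by (simp_all add: image_image)

lemma mem_translate_iff: "y \<in> translate t J \<longleftrightarrow> site_add y (site_neg t) \<in> J"
  by (auto intro!: image_eqI[of _ _ "site_add y (site_neg t)"])

lemma translate_subset_iff: "translate t J \<subseteq> K \<longleftrightarrow> J \<subseteq> translate (site_neg t) K"
  by (auto simp: subset_iff mem_translate_iff simp del: image_iff)

lemma box_eq_PiE: "box n = PiE UNIV (\<lambda>_. {0..<int n})"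
  by (auto simp: box_def PiE_def)

lemma finite_box [simp]: "finite (box n :: ('d::finite \<Rightarrow> int) set)"
  unfolding box_eq_PiE by (rule finite_PiE) auto

lemma card_box: "card (box n :: ('d::finite \<Rightarrow> int) set) = n ^ CARD('d)"
  unfolding box_eq_PiE by (simp add: card_PiE)

lemma card_box_pos: "0 < n \<Longrightarrow> 0 < card (box n :: ('d::finite \<Rightarrow> int) set)"
  by (simp add: card_box)

lemma finite_margin [simp]: "finite (margin n k)"
  by (simp add: margin_def)

text \<open>The complement of the margin is a translate of the box of side \<open>n - 2 * k\<close>,
  so for \<open>n > 2 * k\<close> the density has a closed form.\<close>

lemma margin_density_tendsto_0:
  "(\<lambda>n. card (margin n k :: ('d::finite \<Rightarrow> int) set) / card (box n :: ('d \<Rightarrow> int) set)) \<longlonglongrightarrow> 0"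
proof -
  have "card (margin n k :: ('d \<Rightarrow> int) set) / card (box n :: ('d \<Rightarrow> int) set)
      = 1 - (1 - 2 * real k / real n) ^ CARD('d)" if n: "n > 2 * k" for n
  proof -
    let ?I = "translate (\<lambda>_. int k) (box (n - 2 * k)) :: ('d \<Rightarrow> int) set"
    have eq: "margin n k = box n - ?I"
    proof (intro equalityI subsetI)
      fix y :: "'d \<Rightarrow> int" assume y: "y \<in> box n - ?I"
      show "y \<in> margin n k"
      proof (rule ccontr)
        assume "y \<notin> margin n k"
        with y have "\<forall>i. int k \<le> y i \<and> y i < int n - int k"
          by (auto simp: margin_def not_less not_le)
        then have "(\<lambda>i. y i - int k) \<in> box (n - 2 * k)"
          using n by (auto simp: box_def of_nat_diff) (smt (verit) of_nat_0_le_iff)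
        moreover have "y = site_add (\<lambda>i. y i - int k) (\<lambda>_. int k)" by (simp add: site_add_def)
        ultimately show False using y by blast
      qed
    next
      fix y :: "'d \<Rightarrow> int" assume "y \<in> margin n k"
      then obtain i where y: "y \<in> box n" and i: "y i < int k \<or> int n - int k \<le> y i"
        by (auto simp: margin_def)
      have "y \<noteq> site_add z (\<lambda>_. int k)" if "z \<in> box (n - 2 * k)" for z
      proof
        assume "y = site_add z (\<lambda>_. int k)"
        moreover have "0 \<le> z i" "z i < int n - 2 * int k" using that n by (auto simp: box_def of_nat_diff)
        ultimately show False using i by (simp add: site_add_def)
      qed
      with y show "y \<in> box n - ?I" by blast
    qed
    have sub: "?I \<subseteq> box n"
      using n by (auto simp: box_def site_add_def of_nat_diff) (smt (verit) of_nat_0_le_iff)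
    have "card (margin n k :: ('d \<Rightarrow> int) set) = n ^ CARD('d) - (n - 2 * k) ^ CARD('d)"
      unfolding eq by (subst card_Diff_subset) (use sub in \<open>auto simp: card_image card_box\<close>)
    moreover have "(n - 2 * k) ^ CARD('d) \<le> n ^ CARD('d)" by (rule power_mono) auto
    ultimately have "real (card (margin n k :: ('d \<Rightarrow> int) set)) = real n ^ CARD('d) - (real n - 2 * real k) ^ CARD('d)"
      using n by (simp add: of_nat_diff)
    moreover have "1 - 2 * real k / real n = (real n - 2 * real k) / real n"
      using n by (simp add: field_simps)
    then have "(1 - 2 * real k / real n) ^ CARD('d) = (real n - 2 * real k) ^ CARD('d) / real n ^ CARD('d)"
      by (simp only: power_divide)
    ultimately show ?thesis
      using n by (simp only: card_box of_nat_power) (simp add: divide_simps)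
  qed
  then have "eventually (\<lambda>n. 1 - (1 - 2 * real k / real n) ^ CARD('d)
      = card (margin n k :: ('d \<Rightarrow> int) set) / card (box n :: ('d \<Rightarrow> int) set)) sequentially"
    by (intro eventually_sequentiallyI[of "Suc (2 * k)"]) auto
  moreover have "(\<lambda>n. 1 - (1 - 2 * real k / real n) ^ CARD('d)) \<longlonglongrightarrow> 1 - (1 - 0) ^ CARD('d)"
    by (intro tendsto_intros lim_const_over_n)
  ultimately show ?thesis by (simp add: Lim_transform_eventually)
qed

section \<open>Block entropies of translates, and convergence of entropy densities\<close>

lemma vimage_shift_cylinder:
  "shift t -` cylinder J w = cylinder (translate t J) (shift (site_neg t) w)"
  by (auto simp: cylinder_def shift_def)

text \<open>The index set \<open>blocks J\<close> is the same for every \<open>t\<close>, so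
  entropies of different translates can be averaged term by term.\<close>

lemma block_entropy_translate:
  "block_entropy M (translate t J)
    = (\<Sum>w\<in>blocks J. - (measure M (shift t -` cylinder J w) * ln (measure M (shift t -` cylinder J w))))"
  unfolding block_entropy_eq_sum_information information_def vimage_shift_cylinder
proof (rule sum.reindex_bij_witness[where j = "\<lambda>w. restrict (shift t w) J"
      and i = "\<lambda>w. restrict (shift (site_neg t) w) (translate t J)"], goal_cases)
  case (5 w)
  have "cylinder (translate t J) (shift (site_neg t) (restrict (shift t w) J)) = cylinder (translate t J) w"
    by (rule cylinder_cong) (auto simp: shift_def)
  then show ?case by simp
qed (auto simp: fun_eq_iff shift_def PiE_def extensional_def)

text \<open>For each residue \<open>s\<close> modulo \<open>m\<close>, the tiles of side
  \<open>m\<close> with corners congruent to \<open>s\<close> cover the box up to a margin; summing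
  over all residues uses every corner once. It is stated for arbitrary laws because it is also
  applied to finite-volume Gibbs measures before they are averaged.\<close>

lemma (in config_prob) block_entropy_grid:
  assumes m: "m > 0"
  shows "card (box m :: ('d \<Rightarrow> int) set) * block_entropy M (box n)
    \<le> (\<Sum>t\<in>box n. block_entropy M (translate t (box m)))
      + card (box m :: ('d \<Rightarrow> int) set) * (card (margin n m :: ('d \<Rightarrow> int) set) * ln CARD('a))"
proof -
  define T where "T s = {t \<in> box n. (\<lambda>i. t i mod int m) = s}" for s :: "'d \<Rightarrow> int"
  have finT [simp]: "finite (T s)" for s by (simp add: T_def)
  have bound: "block_entropy M (box n)
      \<le> (\<Sum>t\<in>T s. block_entropy M (translate t (box m))) + card (margin n m :: ('d \<Rightarrow> int) set) * ln CARD('a)"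
    if s: "s \<in> box m" for s
  proof -
    let ?U = "\<Union>t\<in>T s. translate t (box m)"
    have "box n \<subseteq> ?U \<union> margin n m"
    proof
      fix y :: "'d \<Rightarrow> int" assume y: "y \<in> box n"
      show "y \<in> ?U \<union> margin n m"
      proof (cases "y \<in> margin n m")
        case False
        \<comment> \<open>\<open>u\<close> is the position of \<open>y\<close> inside its tile and
          \<open>t\<close> the corner of that tile; distance \<open>m\<close> from the faces forces
          the corner into the box. Tiles of \<open>T s\<close> that stick out do no harm, since
          monotonicity gives an upper bound all the same.\<close>
        define u where "u = (\<lambda>i. (y i - s i) mod int m)"
        define t where "t = (\<lambda>i. y i - u i)"
        have u: "0 \<le> u i" "u i < int m" for i using m by (auto simp: u_def)
        have "\<not> (\<exists>i. y i < int m \<or> int n - int m \<le> y i)"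
          using False y by (simp add: margin_def)
        then have "int m \<le> y i \<and> y i < int n" for i
          using y by (auto simp: box_def not_less)
        then have "0 \<le> t i" "t i < int n" for i
          unfolding t_def using u[of i] by (smt (verit))+
        moreover have "t i mod int m = s i" for i
        proof -
          have "t i mod int m = (y i - (y i - s i)) mod int m"
            unfolding t_def u_def by (rule mod_diff_right_eq)
          also have "\<dots> = s i" using s by (simp add: box_def)
          finally show ?thesis .
        qed
        ultimately have "t \<in> T s" by (auto simp: T_def box_def)
        moreover have "y = site_add u t" "u \<in> box m" using u by (auto simp: t_def site_add_def box_def)
        ultimately show ?thesis by blast
      qed simp
    qed
    then have "block_entropy M (box n) \<le> block_entropy M (?U \<union> margin n m)"
      by (intro block_entropy_mono) auto
    also have "\<dots> \<le> block_entropy M ?U + block_entropy M (margin n m)"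
      by (intro block_entropy_subadditive) auto
    also have "\<dots> \<le> (\<Sum>t\<in>T s. block_entropy M (translate t (box m))) + card (margin n m :: ('d \<Rightarrow> int) set) * ln CARD('a)"
      by (intro add_mono block_entropy_UN block_entropy_le_card) auto
    finally show ?thesis .
  qed
  have "card (box m :: ('d \<Rightarrow> int) set) * block_entropy M (box n) = (\<Sum>s\<in>(box m :: ('d \<Rightarrow> int) set). block_entropy M (box n))"
    by simp
  also have "\<dots> \<le> (\<Sum>s\<in>box m. (\<Sum>t\<in>T s. block_entropy M (translate t (box m))) + card (margin n m :: ('d \<Rightarrow> int) set) * ln CARD('a))"
    by (rule sum_mono) (rule bound)
  also have "\<dots> = (\<Sum>s\<in>box m. \<Sum>t\<in>T s. block_entropy M (translate t (box m)))
      + card (box m :: ('d \<Rightarrow> int) set) * (card (margin n m :: ('d \<Rightarrow> int) set) * ln CARD('a))"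
    by (simp add: sum.distrib)
  also have "(\<Sum>s\<in>box m. \<Sum>t\<in>T s. block_entropy M (translate t (box m))) = (\<Sum>t\<in>box n. block_entropy M (translate t (box m)))"
    unfolding T_def using m by (intro sum.group finite_box) (auto simp: box_def)
  finally show ?thesis .
qed

lemma density_le_add_density:
  "0 < V \<Longrightarrow> 0 < W \<Longrightarrow> V * b \<le> W * c + V * (k * l) \<Longrightarrow> b / W \<le> c / V + k / W * (l :: real)"
  by (simp add: field_simps)

text \<open>The sequence converges to its infimum over positive indices: a nearly optimal
  \<open>m\<close> controls all large \<open>n\<close> up to the vanishing error
  \<open>r m n\<close>.\<close>

lemma fekete_tendsto:
  fixes a :: "nat \<Rightarrow> real"
  assumes nonneg: "\<And>n. 0 \<le> a n"
    and le: "\<And>m n. 0 < m \<Longrightarrow> 0 < n \<Longrightarrow> a n \<le> a m + r m n"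
    and r: "\<And>m. 0 < m \<Longrightarrow> r m \<longlonglongrightarrow> 0"
  shows "a \<longlonglongrightarrow> lim a" "0 < m \<Longrightarrow> lim a \<le> a m"
proof -
  define L where "L = (INF n\<in>{0<..}. a n)"
  have bdd: "bdd_below (a ` {0<..})" using nonneg by (intro bdd_belowI[of _ 0]) auto
  have Lle: "L \<le> a n" if "0 < n" for n
    unfolding L_def using that by (intro cINF_lower bdd) auto
  have "a \<longlonglongrightarrow> L"
  proof (rule order_tendstoI)
    fix y assume "y < L"
    then show "eventually (\<lambda>n. y < a n) sequentially"
      using Lle by (intro eventually_sequentiallyI[of 1]) (auto intro: less_le_trans)
  next
    fix y assume "L < y"
    then obtain m where m: "0 < m" "a m < y"
      unfolding L_def by (subst (asm) cINF_less_iff) (auto intro: bdd)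
    have "eventually (\<lambda>n. r m n < y - a m) sequentially"
      using order_tendstoD(2)[OF r[OF m(1)], of "y - a m"] m(2) by simp
    with eventually_gt_at_top[of 0] show "eventually (\<lambda>n. a n < y) sequentially"
    proof eventually_elim
      case (elim n) then show ?case using le[OF m(1), of n] by linarith
    qed
  qed
  then have "lim a = L" "a \<longlonglongrightarrow> lim a" by (auto dest: limI)
  then show "a \<longlonglongrightarrow> lim a" "0 < m \<Longrightarrow> lim a \<le> a m" using Lle by auto
qed

section \<open>Invariant measures and their entropy density\<close>

lemma space_full_shift [simp]: "space full_shift_space = UNIV"
  by (simp add: full_shift_space_def space_PiM PiE_def)

lemma cylinder_in_full_shift_space:
  assumes "finite J"
  shows "cylinder J (w :: ('d \<Rightarrow> int) \<Rightarrow> 'a) \<in> sets full_shift_space"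
proof -
  have "(\<lambda>x. x m) \<in> measurable (full_shift_space :: (('d \<Rightarrow> int) \<Rightarrow> 'a) measure) (count_space UNIV)" for m
    unfolding full_shift_space_def by (rule measurable_component_singleton) simp
  then have "{x. x m = w m} \<in> sets (full_shift_space :: (('d \<Rightarrow> int) \<Rightarrow> 'a) measure)" for m
    using measurable_sets[of "\<lambda>x. x m" full_shift_space "count_space UNIV" "{w m}"]
    by (simp add: vimage_def)
  then have "(\<Inter>m\<in>J. {x. x m = w m}) \<in> sets full_shift_space" if "J \<noteq> {}"
    using assms that by (intro sets.finite_INT) auto
  moreover have "cylinder J w = (\<Inter>m\<in>J. {x. x m = w m})" by (auto simp: cylinder_def)
  moreover have "cylinder {} w = space full_shift_space" by (auto simp: cylinder_def)
  ultimately show ?thesis by (cases "J = {}") (metis sets.top, metis)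
qed

lemma measurable_shift: "shift t \<in> measurable full_shift_space full_shift_space"
  unfolding full_shift_space_def shift_def by (rule measurable_PiM_single') (auto simp: space_PiM)

lemma config_prob_invariant:
  assumes "\<mu> \<in> invariant_measures" shows "config_prob \<mu>"
proof -
  have \<mu>: "sets \<mu> = sets full_shift_space" "prob_space \<mu>"
    using assms by (auto simp: invariant_measures_def)
  interpret prob_space \<mu> by fact
  show ?thesis
    using sets_eq_imp_space_eq[OF \<mu>(1)] cylinder_in_full_shift_space
    by unfold_locales (auto simp: \<mu>(1))
qed

lemma
  assumes "\<mu> \<in> invariant_measures"
  shows measurable_shift_invariant: "shift t \<in> measurable \<mu> \<mu>"
    and measure_vimage_shift: "A \<in> sets \<mu> \<Longrightarrow> measure \<mu> (shift t -` A) = measure \<mu> A"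
proof -
  have \<mu>: "sets \<mu> = sets full_shift_space" "distr \<mu> \<mu> (shift t) = \<mu>"
    using assms by (auto simp: invariant_measures_def)
  show m: "shift t \<in> measurable \<mu> \<mu>"
    using measurable_shift unfolding measurable_cong_sets[OF \<mu>(1) \<mu>(1)] .
  show "measure \<mu> (shift t -` A) = measure \<mu> A" if "A \<in> sets \<mu>"
    using measure_distr[OF m that] sets_eq_imp_space_eq[OF \<mu>(1)] \<mu>(2) by simp
qed

lemma block_entropy_translate_invariant:
  assumes "\<mu> \<in> invariant_measures" "finite J"
  shows "block_entropy \<mu> (translate t J) = block_entropy \<mu> J"
proof -
  interpret config_prob \<mu> using assms(1) by (rule config_prob_invariant)
  show ?thesis
    unfolding block_entropy_translate using assms
    by (simp add: measure_vimage_shift cylinder_sets block_entropy_eq_sum_information information_def)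
qed

text \<open>By invariance all tiles in \<open>block_entropy_grid\<close> contribute equally, which
  is the hypothesis of \<open>fekete_tendsto\<close>. The inequality feeds
  \<open>pressure_upper\<close>; the limit recovers the entropy of a limit point from its blocks of
  fixed size.\<close>

lemma
  fixes \<mu> :: "(('d::finite \<Rightarrow> int) \<Rightarrow> 'a::finite) measure"
  assumes \<mu>: "\<mu> \<in> invariant_measures"
  shows ms_entropy_tendsto:
      "(\<lambda>n. block_entropy \<mu> (box n) / card (box n :: ('d \<Rightarrow> int) set)) \<longlonglongrightarrow> ms_entropy \<mu>"
    and ms_entropy_le:
      "0 < m \<Longrightarrow> ms_entropy \<mu> \<le> block_entropy \<mu> (box m) / card (box m :: ('d \<Rightarrow> int) set)"
proof -
  interpret config_prob \<mu> using \<mu> by (rule config_prob_invariant)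
  let ?v = "\<lambda>n. real (card (box n :: ('d \<Rightarrow> int) set))"
  let ?a = "\<lambda>n. block_entropy \<mu> (box n) / ?v n"
  let ?r = "\<lambda>m n. card (margin n m :: ('d \<Rightarrow> int) set) / ?v n * ln CARD('a)"
  have nonneg: "0 \<le> ?a n" for n by (simp add: block_entropy_nonneg)
  have le: "?a n \<le> ?a m + ?r m n" if "0 < m" "0 < n" for m n
  proof -
    have pos: "?v m > 0" "?v n > 0" using that card_box_pos by (auto simp: of_nat_0_less_iff simp del: of_nat_power)
    have "?v m * block_entropy \<mu> (box n) \<le> ?v n * block_entropy \<mu> (box m)
        + ?v m * (card (margin n m :: ('d \<Rightarrow> int) set) * ln CARD('a))"
      using block_entropy_grid[OF that(1), of n] \<mu> by (simp add: block_entropy_translate_invariant)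
    then show ?thesis using pos by (intro density_le_add_density)
  qed
  have r: "?r m \<longlonglongrightarrow> 0" for m
    by (intro tendsto_mult_left_zero margin_density_tendsto_0)
  show "?a \<longlonglongrightarrow> ms_entropy \<mu>" unfolding ms_entropy_def by (rule fekete_tendsto[OF nonneg le r])
  show "0 < m \<Longrightarrow> ms_entropy \<mu> \<le> ?a m" unfolding ms_entropy_def by (rule fekete_tendsto[OF nonneg le r])
qed

section \<open>Limit points of asymptotically invariant sequences\<close>

text \<open>For a finite alphabet these are the clopen sets; they form a ring that generates the
  product sigma-algebra.\<close>

definition local_events :: "('i \<Rightarrow> 'a) set set" where
  "local_events = {A. \<exists>J. finite J \<and> depends_on J (\<lambda>x. x \<in> A)}"

lemma ring_of_sets_local_events: "ring_of_sets UNIV (local_events :: ('i \<Rightarrow> 'a) set set)"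
proof -
  have "A \<union> B \<in> local_events \<and> A - B \<in> local_events"
    if "A \<in> local_events" "B \<in> local_events" for A B :: "('i \<Rightarrow> 'a) set"
  proof -
    from that obtain J K where "finite J" "depends_on J (\<lambda>x. x \<in> A)" "finite K" "depends_on K (\<lambda>x. x \<in> B)"
      by (auto simp: local_events_def)
    then have "finite (J \<union> K)" "depends_on (J \<union> K) (\<lambda>x. x \<in> A \<union> B)" "depends_on (J \<union> K) (\<lambda>x. x \<in> A - B)"
      using depends_on_comp2[of J "\<lambda>x. x \<in> A" K "\<lambda>x. x \<in> B" "\<lambda>a b. a \<or> b"]
        depends_on_comp2[of J "\<lambda>x. x \<in> A" K "\<lambda>x. x \<in> B" "\<lambda>a b. a \<and> \<not> b"] by auto
    then show ?thesis unfolding local_events_def by blast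
  qed
  moreover have "{} \<in> (local_events :: ('i \<Rightarrow> 'a) set set)"
    by (auto simp: local_events_def depends_on_def)
  ultimately show ?thesis by (auto simp: ring_of_sets_iff)
qed

lemma UNIV_local_event: "UNIV \<in> local_events"
  by (auto simp: local_events_def depends_on_def)

lemma Int_stable_local_events: "Int_stable (local_events :: ('i \<Rightarrow> 'a) set set)"
proof -
  interpret ring_of_sets UNIV "local_events :: ('i \<Rightarrow> 'a) set set" by (rule ring_of_sets_local_events)
  show ?thesis by (auto simp: Int_stable_def)
qed

text \<open>Compactness of a product of finite discrete spaces: local events are closed, so nonempty
  decreasing ones have a common point. This supplies the continuity at the empty set needed for
  Caratheodory's extension.\<close>

lemma local_events_decseq_empty:
  fixes A :: "nat \<Rightarrow> (('d \<Rightarrow> int) \<Rightarrow> 'a::finite) set"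
  assumes A: "range A \<subseteq> local_events" and dec: "decseq A" and empty: "(\<Inter>i. A i) = {}"
  shows "\<exists>n. A n = {}"
proof (rule ccontr)
  assume ne: "\<nexists>n. A n = {}"
  let ?T = "product_topology (\<lambda>_. discrete_topology UNIV) UNIV :: (('d \<Rightarrow> int) \<Rightarrow> 'a) topology"
  have "closedin ?T (A n)" for n
  proof -
    obtain J where J: "finite J" "depends_on J (\<lambda>x. x \<in> A n)"
      using A by (auto simp: local_events_def)
    have "closedin ?T (cylinder J w)" for w
    proof -
      have "cylinder J w = PiE UNIV (\<lambda>m. if m \<in> J then {w m} else UNIV)"
        by (auto simp: cylinder_def PiE_def Pi_def split: if_splits)
      then show ?thesis by (simp add: closedin_product_topology)
    qed
    then show ?thesis using J
      by (subst local_eq_UN_cylinders[OF J(2)]) (intro closedin_Union, auto)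
  qed
  then have "(\<Inter>i. A i) \<noteq> {}"
    using ne dec by (intro compact_space_imp_nest[of ?T])
      (auto simp: compact_space_product_topology compact_space_discrete_topology)
  with empty show False by simp
qed

lemma sets_full_shift_space:
  "sets (full_shift_space :: (('d \<Rightarrow> int) \<Rightarrow> 'a::finite) measure) = sigma_sets UNIV local_events"
proof (intro equalityI)
  show "sets (full_shift_space :: (('d \<Rightarrow> int) \<Rightarrow> 'a) measure) \<subseteq> sigma_sets UNIV local_events"
    unfolding full_shift_space_def sets_PiM_single
  proof (simp, rule sigma_sets_mono, safe)
    fix i :: "'d \<Rightarrow> int" and A :: "'a set"
    have "depends_on {i} (\<lambda>x. x \<in> {f. f i \<in> A})" by (auto simp: depends_on_def)
    then show "{f. f i \<in> A} \<in> sigma_sets UNIV local_events"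
      by (intro sigma_sets.Basic) (auto simp: local_events_def)
  qed
  show "sigma_sets UNIV local_events \<subseteq> sets (full_shift_space :: (('d \<Rightarrow> int) \<Rightarrow> 'a) measure)"
  proof -
    have "A \<in> sets full_shift_space" if A: "A \<in> local_events" for A :: "(('d \<Rightarrow> int) \<Rightarrow> 'a) set"
    proof -
      obtain J where J: "finite J" "depends_on J (\<lambda>x. x \<in> A)"
        using A by (auto simp: local_events_def)
      then show ?thesis
        by (subst local_eq_UN_cylinders[OF J(2)]) (auto intro!: sets.finite_UN cylinder_in_full_shift_space)
    qed
    then show ?thesis
      using sets.sigma_sets_subset[of local_events "full_shift_space :: (('d \<Rightarrow> int) \<Rightarrow> 'a) measure"] by auto
  qed
qed

text \<open>Tychonoff for a cube indexed by the type \<open>'b\<close>, later that of all sets of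
  configurations. Such a cube need not be sequentially compact, so the limit is taken along a finer
  filter instead of a subsequence.\<close>

lemma prob_set_functions_cluster:
  fixes f :: "nat \<Rightarrow> 'b \<Rightarrow> real"
  assumes f: "\<And>n A. 0 \<le> f n A \<and> f n A \<le> 1"
  obtains L F where "F \<noteq> bot" "F \<le> sequentially" "\<And>A. ((\<lambda>n. f n A) \<longlongrightarrow> L A) F"
proof -
  let ?K = "PiE UNIV (\<lambda>_. {0..1::real}) :: ('b \<Rightarrow> real) set"
  have "compactin (product_topology (\<lambda>_. euclidean) UNIV) ?K"
    by (simp add: compactin_PiE)
  then have "compact ?K"
    by (simp add: euclidean_product_topology)
  moreover have "filtermap f sequentially \<noteq> bot" by (simp add: filtermap_bot_iff)
  moreover have "eventually (\<lambda>x. x \<in> ?K) (filtermap f sequentially)"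
    using f by (simp add: eventually_filtermap PiE_def)
  ultimately obtain L where L: "inf (nhds L) (filtermap f sequentially) \<noteq> bot"
    unfolding compact_filter by blast
  \<comment> \<open>\<open>sequentially\<close> refined by the preimages of neighbourhoods of
    \<open>L\<close>; that \<open>L\<close> is a cluster point says exactly that this filter is
    proper.\<close>
  define F where "F = inf sequentially (filtercomap f (nhds L))"
  have "F \<noteq> bot"
  proof
    assume "F = bot"
    then have "eventually (\<lambda>_. False) F" by simp
    then obtain P Q where P: "eventually P sequentially" and Q: "eventually Q (nhds L)"
      and PQ: "\<And>n. P n \<Longrightarrow> Q (f n) \<Longrightarrow> False"
      unfolding F_def eventually_inf eventually_filtercomap by blast
    have "eventually (\<lambda>x. \<not> Q x) (filtermap f sequentially)"
      unfolding eventually_filtermap using P by eventually_elim (use PQ in auto)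
    with Q have "eventually (\<lambda>_. False) (inf (nhds L) (filtermap f sequentially))"
      unfolding eventually_inf by blast
    with L show False by (simp add: eventually_False)
  qed
  moreover have "F \<le> sequentially" by (simp add: F_def)
  moreover have "((\<lambda>n. f n A) \<longlongrightarrow> L A) F" for A
  proof -
    have "filterlim f (nhds L) F"
      unfolding filterlim_def F_def
      by (meson filtermap_filtercomap filtermap_mono inf.cobounded2 order_trans)
    then show ?thesis
      by (rule continuous_on_tendsto_compose[OF continuous_on_product_coordinates[of A]]) auto
  qed
  ultimately show ?thesis by (rule that)
qed

lemma depends_on_shift:
  fixes f :: "(('d \<Rightarrow> int) \<Rightarrow> 'a) \<Rightarrow> 'b"
  assumes "depends_on J f" shows "depends_on (translate t J) (\<lambda>x. f (shift t x))"
  unfolding depends_on_def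
proof (intro allI impI)
  fix x y :: "('d \<Rightarrow> int) \<Rightarrow> 'a" assume "\<forall>m\<in>translate t J. x m = y m"
  then show "f (shift t x) = f (shift t y)"
    by (intro depends_onD[OF assms]) (auto simp: shift_def)
qed

text \<open>The cluster point \<open>L\<close> is finitely additive and invariant on all sets, but
  countable additivity is obtained only on local events, from where it is extended. Hence the
  convergence is asserted for local events alone.\<close>

lemma invariant_limit_point:
  fixes \<rho> :: "nat \<Rightarrow> (('d::finite \<Rightarrow> int) \<Rightarrow> 'a::finite) pmf"
  assumes inv: "\<And>t A. (\<lambda>n. measure (\<rho> n) (shift t -` A) - measure (\<rho> n) A) \<longlonglongrightarrow> 0"
  obtains \<mu> F where "\<mu> \<in> invariant_measures" "F \<noteq> bot" "F \<le> sequentially"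
    "\<And>A. A \<in> local_events \<Longrightarrow> ((\<lambda>n. measure (\<rho> n) A) \<longlongrightarrow> measure \<mu> A) F"
proof -
  obtain L F where F: "F \<noteq> bot" "F \<le> sequentially"
    and L: "\<And>A. ((\<lambda>n. measure (\<rho> n) A) \<longlongrightarrow> L A) F"
    by (rule prob_set_functions_cluster[of "\<lambda>n A. measure (\<rho> n) A"]) auto
  have L_nonneg: "0 \<le> L A" for A
    by (rule tendsto_lowerbound[OF L _ F(1)]) simp
  have L_UNIV: "L UNIV = 1"
    using tendsto_unique[OF F(1) L[of UNIV], of 1] by (simp add: measure_pmf.prob_space)
  have L_empty: "L {} = 0"
    using tendsto_unique[OF F(1) L[of "{}"], of 0] by simp
  have L_add: "L (A \<union> B) = L A + L B" if "A \<inter> B = {}" for A B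
    using tendsto_unique[OF F(1) L[of "A \<union> B"], of "L A + L B"] tendsto_add[OF L[of A] L[of B]] that
    by (simp add: measure_pmf.finite_measure_Union)
  have L_shift: "L (shift t -` A) = L A" for t A
  proof -
    have "((\<lambda>n. measure (\<rho> n) (shift t -` A) - measure (\<rho> n) A) \<longlongrightarrow> 0) F"
      using inv F(2) by (rule tendsto_mono[rotated])
    from tendsto_unique[OF F(1) this tendsto_diff[OF L L]] show ?thesis by simp
  qed
  interpret R: ring_of_sets UNIV "local_events :: (('d \<Rightarrow> int) \<Rightarrow> 'a) set set"
    by (rule ring_of_sets_local_events)
  have "\<exists>\<mu>. (\<forall>A\<in>local_events. \<mu> A = ennreal (L A)) \<and> measure_space UNIV (sigma_sets UNIV local_events) \<mu>"
  proof (rule R.caratheodory_empty_continuous)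
    show "positive local_events (\<lambda>A. ennreal (L A))" by (simp add: positive_def L_empty)
    show "additive local_events (\<lambda>A. ennreal (L A))"
      using L_nonneg by (auto simp: additive_def L_add ennreal_plus)
    fix A :: "nat \<Rightarrow> (('d \<Rightarrow> int) \<Rightarrow> 'a) set"
    assume A: "range A \<subseteq> local_events" "decseq A" "(\<Inter>i. A i) = {}"
    then obtain n where "A n = {}" using local_events_decseq_empty by blast
    then have "A i = {}" if "i \<ge> n" for i using A(2) that by (auto simp: decseq_def)
    then have "eventually (\<lambda>i. ennreal (L (A i)) = 0) sequentially"
      by (intro eventually_sequentiallyI[of n]) (simp add: L_empty)
    then show "(\<lambda>i. ennreal (L (A i))) \<longlonglongrightarrow> 0" by (rule tendsto_eventually)
  qed simp
  then obtain \<mu>' where \<mu>': "\<And>A. A \<in> local_events \<Longrightarrow> \<mu>' A = ennreal (L A)"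
    and ms: "measure_space UNIV (sigma_sets UNIV (local_events :: (('d \<Rightarrow> int) \<Rightarrow> 'a) set set)) \<mu>'" by blast
  define \<mu> where "\<mu> = measure_of UNIV (sigma_sets UNIV local_events) \<mu>'"
  have sets: "sets \<mu> = sets full_shift_space" and sets': "sets \<mu> = sigma_sets UNIV local_events"
    unfolding \<mu>_def sets_full_shift_space using ms
    by (auto simp: measure_space_def sigma_algebra.sigma_sets_eq)
  have space: "space \<mu> = UNIV" by (simp add: \<mu>_def space_measure_of_conv)
  have em: "emeasure \<mu> A = ennreal (L A)" if "A \<in> local_events" for A
    unfolding \<mu>_def using ms that
    by (subst emeasure_measure_of_sigma) (auto simp: measure_space_def \<mu>')
  have m: "measure \<mu> A = L A" if "A \<in> local_events" for A
    using em[OF that] L_nonneg by (simp add: measure_def)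
  have prob: "prob_space \<mu>"
    by (rule prob_spaceI) (simp add: space em UNIV_local_event L_UNIV)
  have meas: "shift t \<in> measurable \<mu> \<mu>" for t
    using measurable_shift unfolding measurable_cong_sets[OF sets sets] .
  have loc: "A \<in> sets \<mu>" if "A \<in> local_events" for A
    using that by (simp add: sets' sigma_sets.Basic)
  have "distr \<mu> \<mu> (shift t) = \<mu>" for t
  proof (rule measure_eqI_generator_eq[where E = local_events and \<Omega> = UNIV and A = "\<lambda>_. UNIV"])
    show "Int_stable (local_events :: (('d \<Rightarrow> int) \<Rightarrow> 'a) set set)" by (rule Int_stable_local_events)
    show "sets (distr \<mu> \<mu> (shift t)) = sigma_sets UNIV local_events" "sets \<mu> = sigma_sets UNIV local_events"
      by (simp_all add: sets')
    show "range (\<lambda>_. UNIV) \<subseteq> local_events" by (simp add: UNIV_local_event)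
    show "emeasure (distr \<mu> \<mu> (shift t)) UNIV \<noteq> \<infinity>" for i :: nat
      by (simp add: emeasure_distr[OF meas loc] UNIV_local_event em space)
    fix A :: "(('d \<Rightarrow> int) \<Rightarrow> 'a) set" assume A: "A \<in> local_events"
    then obtain J where "finite J" "depends_on J (\<lambda>x. x \<in> A)" by (auto simp: local_events_def)
    then have "shift t -` A \<in> local_events"
      using depends_on_shift[of J "\<lambda>x. x \<in> A" t] by (auto simp: local_events_def)
    then show "emeasure (distr \<mu> \<mu> (shift t)) A = emeasure \<mu> A"
      using A by (simp add: emeasure_distr[OF meas loc] em L_shift space)
  qed auto
  then have "\<mu> \<in> invariant_measures"
    using sets prob by (auto simp: invariant_measures_def)
  then show ?thesis using F L m by (intro that[of \<mu> F]) auto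
qed

section \<open>Energies of finite regions\<close>

locale summable_interaction =
  fixes \<Phi> :: "('d::finite \<Rightarrow> int) set \<Rightarrow> (('d \<Rightarrow> int) \<Rightarrow> 'a::finite) \<Rightarrow> real"
  assumes interaction: "is_interaction \<Phi>"
    and summable: "(\<lambda>\<Lambda>. sup_norm (\<Phi> \<Lambda>)) summable_on {\<Lambda>. finite \<Lambda> \<and> origin \<in> \<Lambda>}"
begin

text \<open>For \<open>F = {}\<close> this is the whole sum of norms, which bounds the
  potential.\<close>

definition tail :: "('d \<Rightarrow> int) set \<Rightarrow> real" where
  "tail F = (\<Sum>\<^sub>\<infinity>\<Lambda>\<in>{\<Lambda>. finite \<Lambda> \<and> origin \<in> \<Lambda> \<and> \<not> \<Lambda> \<subseteq> F}. sup_norm (\<Phi> \<Lambda>))"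

text \<open>The empty set is excluded because it contains no site: neither the potential nor the
  summability hypothesis sees its term. Weights are \<open>exp (\<beta> * energy W x)\<close>,
  without the minus sign of physics.\<close>

definition energy :: "('d \<Rightarrow> int) set \<Rightarrow> (('d \<Rightarrow> int) \<Rightarrow> 'a) \<Rightarrow> real" where
  "energy W x = (\<Sum>\<Lambda>\<in>Pow W - {{}}. \<Phi> \<Lambda> x)"

text \<open>The total norm of the finite sets that meet \<open>W\<close> and leave it, each counted
  once per site of \<open>W\<close> in it. Counting with multiplicity makes it a sum of tails over
  sites, which is easy to estimate per volume.\<close>

definition boundary :: "('d \<Rightarrow> int) set \<Rightarrow> real" where
  "boundary W = (\<Sum>m\<in>W. tail (translate (site_neg m) W))"

definition potential_part :: "('d \<Rightarrow> int) set \<Rightarrow> (('d \<Rightarrow> int) \<Rightarrow> 'a) \<Rightarrow> real" where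
  "potential_part F x = (\<Sum>\<Lambda>\<in>{\<Lambda>. \<Lambda> \<subseteq> F \<and> origin \<in> \<Lambda>}. \<Phi> \<Lambda> x / card \<Lambda>)"

lemma depends_on_interaction: "finite \<Lambda> \<Longrightarrow> depends_on \<Lambda> (\<Phi> \<Lambda>)"
  using interaction by (auto simp: is_interaction_def depends_on_def)

lemma interaction_translate: "finite \<Lambda> \<Longrightarrow> \<Phi> (translate t \<Lambda>) x = \<Phi> \<Lambda> (shift t x)"
  using interaction by (auto simp: is_interaction_def)

lemma abs_interaction_le:
  assumes "finite \<Lambda>" shows "\<bar>\<Phi> \<Lambda> x\<bar> \<le> sup_norm (\<Phi> \<Lambda>)"
proof -
  have "\<Phi> \<Lambda> y \<in> \<Phi> \<Lambda> ` blocks \<Lambda>" for y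
    using depends_onD[OF depends_on_interaction[OF assms], of y "restrict y \<Lambda>"]
    by (intro image_eqI[of _ _ "restrict y \<Lambda>"]) auto
  then have "range (\<lambda>x. \<bar>\<Phi> \<Lambda> x\<bar>) \<subseteq> abs ` \<Phi> \<Lambda> ` blocks \<Lambda>" by auto
  then have "finite (range (\<lambda>x. \<bar>\<Phi> \<Lambda> x\<bar>))"
    by (rule finite_subset) (use assms in auto)
  then show ?thesis unfolding sup_norm_def
    by (intro cSUP_upper bdd_above_finite) auto
qed

lemma sup_norm_nonneg: "finite \<Lambda> \<Longrightarrow> 0 \<le> sup_norm (\<Phi> \<Lambda>)"
  using abs_interaction_le[of \<Lambda> undefined] by linarith

lemma sup_norm_translate:
  assumes "finite \<Lambda>" shows "sup_norm (\<Phi> (translate t \<Lambda>)) = sup_norm (\<Phi> \<Lambda>)"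
proof -
  have "surj (shift t :: (('d \<Rightarrow> int) \<Rightarrow> 'a) \<Rightarrow> _)"
    by (rule surjI[of _ "shift (site_neg t)"]) simp
  then have "range (\<lambda>x. \<bar>\<Phi> \<Lambda> (shift t x)\<bar>) = range (\<lambda>x. \<bar>\<Phi> \<Lambda> x\<bar>)"
    by (metis (mono_tags, lifting) image_cong image_image)
  then show ?thesis using assms by (simp add: sup_norm_def interaction_translate)
qed

lemma summable_sub: "S \<subseteq> {\<Lambda>. finite \<Lambda> \<and> origin \<in> \<Lambda>} \<Longrightarrow> (\<lambda>\<Lambda>. sup_norm (\<Phi> \<Lambda>)) summable_on S"
  using summable by (rule summable_on_subset_banach)

lemma tail_nonneg: "0 \<le> tail F"
  unfolding tail_def by (rule infsum_nonneg) (simp add: sup_norm_nonneg)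

lemma tail_antimono: "F \<subseteq> G \<Longrightarrow> tail G \<le> tail F"
  unfolding tail_def by (intro infsum_mono2 summable_sub) (auto simp: sup_norm_nonneg)

text \<open>Finitely many sets carry all but \<open>\<epsilon>\<close> of the sum, and some cube
  contains their union; sets not inside \<open>F\<close> are among the rest.\<close>

lemma tail_small:
  assumes "\<epsilon> > 0"
  obtains k :: nat where "\<And>F. {y. \<forall>i. \<bar>y i\<bar> \<le> int k} \<subseteq> F \<Longrightarrow> tail F < \<epsilon>"
proof -
  let ?S = "{\<Lambda>. finite \<Lambda> \<and> (origin :: 'd \<Rightarrow> int) \<in> \<Lambda>}" and ?f = "\<lambda>\<Lambda>. sup_norm (\<Phi> \<Lambda>)"
  have "eventually (\<lambda>X. dist (sum ?f X) (infsum ?f ?S) < \<epsilon>) (finite_subsets_at_top ?S)"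
    using infsum_tendsto[OF summable] assms by (rule tendstoD)
  then obtain X where X: "finite X" "X \<subseteq> ?S" and d: "dist (sum ?f X) (infsum ?f ?S) < \<epsilon>"
    unfolding eventually_finite_subsets_at_top by blast
  define k where "k = Max (insert 0 ((\<lambda>(y, i). nat \<bar>y i\<bar>) ` (\<Union>X \<times> UNIV)))"
  have "finite (\<Union>X)" using X by (intro finite_Union) auto
  then have finU: "finite (\<Union>X \<times> (UNIV :: 'd set))" by simp
  have k: "\<bar>y i\<bar> \<le> int k" if "\<Lambda> \<in> X" "y \<in> \<Lambda>" for \<Lambda> y i
  proof -
    have "nat \<bar>y i\<bar> \<le> k"
      unfolding k_def using finU that by (intro Max_ge) (auto intro!: image_eqI[of _ _ "(y, i)"])
    then show ?thesis by simp
  qed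
  show ?thesis
  proof (rule that[of k])
    fix F :: "('d \<Rightarrow> int) set" assume F: "{y. \<forall>i. \<bar>y i\<bar> \<le> int k} \<subseteq> F"
    have "infsum ?f ?S = infsum ?f (X \<union> (?S - X))" using X by (simp add: Un_absorb1)
    also have "\<dots> = infsum ?f X + infsum ?f (?S - X)"
      using X by (intro infsum_Un_disjoint summable_sub) auto
    finally have "infsum ?f (?S - X) < \<epsilon>"
      using d X by (simp add: dist_real_def)
    moreover have "tail F \<le> infsum ?f (?S - X)"
      unfolding tail_def
    proof (rule infsum_mono2)
      have "\<Lambda> \<subseteq> F" if "\<Lambda> \<in> X" for \<Lambda> using F k[OF that] by auto
      then show "{\<Lambda>. finite \<Lambda> \<and> origin \<in> \<Lambda> \<and> \<not> \<Lambda> \<subseteq> F} \<subseteq> ?S - X" by auto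
    qed (auto intro!: summable_sub simp: sup_norm_nonneg)
    ultimately show "tail F < \<epsilon>" by simp
  qed
qed

text \<open>Translating by \<open>site_neg m\<close> turns sets through \<open>m\<close> into sets
  through the origin without changing norms.\<close>

lemma sum_le_tail:
  assumes "finite S" "S \<subseteq> {\<Lambda>. finite \<Lambda> \<and> m \<in> \<Lambda> \<and> \<not> \<Lambda> \<subseteq> W}"
  shows "(\<Sum>\<Lambda>\<in>S. sup_norm (\<Phi> \<Lambda>)) \<le> tail (translate (site_neg m) W)"
proof -
  let ?t = "\<lambda>\<Lambda>. translate (site_neg m) \<Lambda>"
  have inj: "inj_on ?t S"
    by (intro inj_onI) (metis inj_image_eq_iff inj_site_add)
  have "(\<Sum>\<Lambda>\<in>S. sup_norm (\<Phi> \<Lambda>)) = (\<Sum>\<Lambda>\<in>S. sup_norm (\<Phi> (?t \<Lambda>)))"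
    using assms by (intro sum.cong refl) (auto simp: sup_norm_translate subset_iff)
  also have "\<dots> = (\<Sum>\<Lambda>\<in>?t ` S. sup_norm (\<Phi> \<Lambda>))" by (simp add: sum.reindex[OF inj])
  also have "\<dots> \<le> tail (?t W)"
    unfolding tail_def
  proof (rule finite_sum_le_infsum)
    have "origin \<in> ?t \<Lambda> \<and> \<not> ?t \<Lambda> \<subseteq> ?t W \<and> finite (?t \<Lambda>)" if "\<Lambda> \<in> S" for \<Lambda>
    proof -
      have L: "finite \<Lambda>" "m \<in> \<Lambda>" "\<not> \<Lambda> \<subseteq> W" using assms that by auto
      then show ?thesis
        using inj_image_subset_iff[OF inj_site_add[of "site_neg m" UNIV], of \<Lambda> W]
        by (auto intro!: image_eqI[of _ _ m])
    qed
    then show "?t ` S \<subseteq> {\<Lambda>. finite \<Lambda> \<and> origin \<in> \<Lambda> \<and> \<not> \<Lambda> \<subseteq> ?t W}" by auto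
  qed (use assms in \<open>auto intro!: summable_sub simp: sup_norm_nonneg\<close>)
  finally show ?thesis .
qed

lemma depends_on_energy: "finite W \<Longrightarrow> depends_on W (energy W)"
  unfolding depends_on_def energy_def
  by (intro allI impI sum.cong refl depends_onD[OF depends_on_interaction]) (auto dest: finite_subset)

lemma depends_on_potential_part: "finite F \<Longrightarrow> depends_on F (potential_part F)"
  unfolding depends_on_def potential_part_def
  by (intro allI impI sum.cong refl arg_cong2[where f = "(/)"] depends_onD[OF depends_on_interaction])
    (auto dest: finite_subset)

lemma energy_translate:
  assumes "finite W" shows "energy (translate t W) x = energy W (shift t x)"
proof -
  show ?thesis
    unfolding energy_def
  proof (rule sum.reindex_bij_witness[where i = "\<lambda>\<Lambda>. translate t \<Lambda>" and j = "\<lambda>\<Lambda>. translate (site_neg t) \<Lambda>"], goal_cases)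
    case (5 \<Lambda>)
    then have "finite \<Lambda>" using assms by (auto dest: finite_subset)
    then show ?case by (simp add: interaction_translate)
  qed (auto simp: translate_subset_iff simp del: image_subset_iff)
qed

lemma boundary_translate: "boundary (translate t W) = boundary W"
proof -
  have "translate (site_neg (site_add m t)) (translate t W) = translate (site_neg m) W" for m
    by (simp add: image_image site_add_def site_neg_def)
  then show ?thesis unfolding boundary_def by (simp add: sum.reindex)
qed

lemma boundary_nonneg: "0 \<le> boundary W"
  unfolding boundary_def by (intro sum_nonneg tail_nonneg)

lemma potential_part_approx:
  assumes "finite F" shows "\<bar>potential \<Phi> x - potential_part F x\<bar> \<le> tail F"
proof -
  let ?S = "{\<Lambda>. finite \<Lambda> \<and> (origin :: 'd \<Rightarrow> int) \<in> \<Lambda>}"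
  let ?A = "{\<Lambda>. \<Lambda> \<subseteq> F \<and> origin \<in> \<Lambda>}" and ?B = "{\<Lambda>. finite \<Lambda> \<and> origin \<in> \<Lambda> \<and> \<not> \<Lambda> \<subseteq> F}"
  let ?g = "\<lambda>\<Lambda>. \<Phi> \<Lambda> x / card \<Lambda>"
  have S: "?S = ?A \<union> ?B" using assms by (auto dest: finite_subset)
  have finA: "finite ?A" using assms by (auto intro: finite_subset[of _ "Pow F"])
  have g: "norm (?g \<Lambda>) \<le> sup_norm (\<Phi> \<Lambda>)" if "\<Lambda> \<in> ?S" for \<Lambda>
  proof -
    have "card \<Lambda> \<ge> 1" using that by (auto simp: Suc_le_eq card_gt_0_iff)
    then have "\<bar>\<Phi> \<Lambda> x\<bar> / card \<Lambda> \<le> \<bar>\<Phi> \<Lambda> x\<bar> / 1" by (intro divide_left_mono) auto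
    then show ?thesis using abs_interaction_le[of \<Lambda> x] that by simp
  qed
  have "(\<lambda>\<Lambda>. norm (sup_norm (\<Phi> \<Lambda>))) summable_on ?B \<longleftrightarrow> (\<lambda>\<Lambda>. sup_norm (\<Phi> \<Lambda>)) summable_on ?B"
    by (rule summable_on_cong) (simp add: sup_norm_nonneg)
  then have "(\<lambda>\<Lambda>. norm (sup_norm (\<Phi> \<Lambda>))) summable_on ?B"
    using summable_sub[of ?B] by blast
  then have abs: "(\<lambda>\<Lambda>. norm (?g \<Lambda>)) summable_on ?B"
  proof (rule Infinite_Sum.abs_summable_on_comparison_test)
    fix \<Lambda> assume "\<Lambda> \<in> ?B"
    then show "norm (?g \<Lambda>) \<le> norm (sup_norm (\<Phi> \<Lambda>))" using g[of \<Lambda>] by (simp add: sup_norm_nonneg)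
  qed
  have "potential \<Phi> x = infsum ?g ?A + infsum ?g ?B"
    unfolding potential_def S using finA abs_summable_summable[OF abs]
    by (intro infsum_Un_disjoint) auto
  also have "infsum ?g ?A = potential_part F x" using finA by (simp add: potential_part_def)
  finally have "\<bar>potential \<Phi> x - potential_part F x\<bar> = norm (infsum ?g ?B)" by simp
  also have "\<dots> \<le> infsum (\<lambda>\<Lambda>. norm (?g \<Lambda>)) ?B" using abs by (rule norm_infsum_bound)
  also have "\<dots> \<le> tail F"
    unfolding tail_def using abs g by (intro infsum_mono summable_sub) auto
  finally show ?thesis .
qed

text \<open>A set \<open>\<Lambda>\<close> inside \<open>W\<close> is met once from each of its
  sites with weight \<open>1 / card \<Lambda>\<close>, which adds up to one full
  \<open>\<Phi> \<Lambda>\<close>. What the truncation at a site \<open>m\<close> omits are sets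
  leaving \<open>W\<close>.\<close>

lemma sum_potential_approx_energy:
  assumes "finite W" shows "\<bar>(\<Sum>m\<in>W. potential \<Phi> (shift m x)) - energy W x\<bar> \<le> boundary W"
proof -
  let ?P = "Pow W - {{}}"
  have part: "potential_part (translate (site_neg m) W) (shift m x) = (\<Sum>\<Lambda>\<in>{\<Lambda>\<in>?P. m \<in> \<Lambda>}. \<Phi> \<Lambda> x / card \<Lambda>)"
    if "m \<in> W" for m
    unfolding potential_part_def
  proof (rule sum.reindex_bij_witness[where i = "\<lambda>\<Lambda>. translate (site_neg m) \<Lambda>" and j = "\<lambda>\<Lambda>. translate m \<Lambda>"], goal_cases)
    case (2 \<Lambda>)
    then show ?case by (auto simp: translate_subset_iff mem_translate_iff simp del: image_subset_iff)
  next
    case (4 \<Lambda>)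
    then show ?case by (auto simp: translate_subset_iff mem_translate_iff simp del: image_subset_iff)
  next
    case (5 \<Lambda>)
    then have "finite \<Lambda>" using assms by (auto dest: finite_subset)
    then show ?case by (simp add: interaction_translate card_image)
  qed auto
  have "(\<Sum>m\<in>W. potential_part (translate (site_neg m) W) (shift m x))
      = (\<Sum>m\<in>W. \<Sum>\<Lambda>\<in>{\<Lambda>\<in>?P. m \<in> \<Lambda>}. \<Phi> \<Lambda> x / card \<Lambda>)"
    by (intro sum.cong refl part)
  also have "\<dots> = (\<Sum>\<Lambda>\<in>?P. \<Sum>m\<in>{m\<in>W. m \<in> \<Lambda>}. \<Phi> \<Lambda> x / card \<Lambda>)"
    using assms by (intro sum.swap_restrict) auto
  also have "\<dots> = energy W x"
    unfolding energy_def
  proof (rule sum.cong[OF refl])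
    fix \<Lambda> assume L: "\<Lambda> \<in> ?P"
    then have "{m\<in>W. m \<in> \<Lambda>} = \<Lambda>" "card \<Lambda> \<noteq> 0" using assms by (auto dest: finite_subset)
    then show "(\<Sum>m\<in>{m\<in>W. m \<in> \<Lambda>}. \<Phi> \<Lambda> x / card \<Lambda>) = \<Phi> \<Lambda> x" by simp
  qed
  finally have "(\<Sum>m\<in>W. potential \<Phi> (shift m x)) - energy W x
      = (\<Sum>m\<in>W. potential \<Phi> (shift m x) - potential_part (translate (site_neg m) W) (shift m x))"
    by (simp add: sum_subtractf)
  also have "\<bar>\<dots>\<bar> \<le> boundary W"
    unfolding boundary_def using assms
    by (intro order_trans[OF sum_abs] sum_mono potential_part_approx) auto
  finally show ?thesis .
qed

text \<open>This is the step that needs summability of the norms themselves and not just of the norms divided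
  by the cardinalities.\<close>

lemma energy_replace:
  assumes "finite B" "W \<subseteq> B" and eq: "\<And>m. m \<notin> W \<Longrightarrow> x m = y m"
  shows "\<bar>(energy B y - energy B x) - (energy W y - energy W x)\<bar> \<le> 2 * boundary W"
proof -
  have finW: "finite W" using assms finite_subset by blast
  let ?D = "\<lambda>\<Lambda>. \<Phi> \<Lambda> y - \<Phi> \<Lambda> x"
  \<comment> \<open>The sets crossing the border of \<open>W\<close>: those inside are accounted for
    by \<open>energy W\<close>, and those disjoint from \<open>W\<close> do not see the change. Each
    member of \<open>Q\<close> is charged to the sites of \<open>W\<close> in it, at least one; the
    factor 2 arises because \<open>x\<close> and \<open>y\<close> are both bounded by the
    norm.\<close>
  define Q where "Q = {\<Lambda>\<in>Pow B. \<Lambda> \<inter> W \<noteq> {} \<and> \<not> \<Lambda> \<subseteq> W}"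
  have finQ: "finite Q" and QB: "\<And>\<Lambda>. \<Lambda> \<in> Q \<Longrightarrow> finite \<Lambda>"
    using assms(1) by (auto simp: Q_def dest: finite_subset)
  have "energy B y - energy B x = sum ?D (Pow B - {{}})" by (simp add: energy_def sum_subtractf)
  also have "\<dots> = sum ?D ((Pow W - {{}}) \<union> Q)"
  proof (rule sum.mono_neutral_right)
    show "\<forall>\<Lambda>\<in>Pow B - {{}} - ((Pow W - {{}}) \<union> Q). ?D \<Lambda> = 0"
    proof
      fix \<Lambda> assume L: "\<Lambda> \<in> Pow B - {{}} - ((Pow W - {{}}) \<union> Q)"
      then have "\<Lambda> \<inter> W = {}" "finite \<Lambda>" using assms by (auto simp: Q_def dest: finite_subset)
      then have "\<Phi> \<Lambda> y = \<Phi> \<Lambda> x"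
        using eq by (intro depends_onD[OF depends_on_interaction]) (auto, metis disjoint_iff)
      then show "?D \<Lambda> = 0" by simp
    qed
  qed (use assms in \<open>auto simp: Q_def\<close>)
  also have "\<dots> = (energy W y - energy W x) + sum ?D Q"
    using finW finQ by (subst sum.union_disjoint) (auto simp: Q_def energy_def sum_subtractf)
  finally have "\<bar>(energy B y - energy B x) - (energy W y - energy W x)\<bar> = \<bar>sum ?D Q\<bar>" by simp
  also have "\<dots> \<le> (\<Sum>\<Lambda>\<in>Q. \<bar>?D \<Lambda>\<bar>)" by (rule sum_abs)
  also have "\<dots> \<le> (\<Sum>\<Lambda>\<in>Q. \<Sum>m\<in>{m\<in>W. m \<in> \<Lambda>}. 2 * sup_norm (\<Phi> \<Lambda>))"
  proof (rule sum_mono)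
    fix \<Lambda> assume L: "\<Lambda> \<in> Q"
    have "\<bar>?D \<Lambda>\<bar> \<le> 2 * sup_norm (\<Phi> \<Lambda>)"
      using abs_interaction_le[OF QB[OF L], of x] abs_interaction_le[OF QB[OF L], of y] by linarith
    moreover have "{m\<in>W. m \<in> \<Lambda>} \<noteq> {}" using L by (auto simp: Q_def)
    then have "1 \<le> card {m\<in>W. m \<in> \<Lambda>}" using finW by (simp add: Suc_le_eq card_gt_0_iff)
    then have "1 * (2 * sup_norm (\<Phi> \<Lambda>)) \<le> card {m\<in>W. m \<in> \<Lambda>} * (2 * sup_norm (\<Phi> \<Lambda>))"
      using sup_norm_nonneg[OF QB[OF L]] by (intro mult_right_mono) auto
    ultimately show "\<bar>?D \<Lambda>\<bar> \<le> (\<Sum>m\<in>{m\<in>W. m \<in> \<Lambda>}. 2 * sup_norm (\<Phi> \<Lambda>))" by simp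
  qed
  also have "\<dots> = (\<Sum>m\<in>W. \<Sum>\<Lambda>\<in>{\<Lambda>\<in>Q. m \<in> \<Lambda>}. 2 * sup_norm (\<Phi> \<Lambda>))"
    using finW finQ by (intro sum.swap_restrict) auto
  also have "\<dots> = (\<Sum>m\<in>W. 2 * (\<Sum>\<Lambda>\<in>{\<Lambda>\<in>Q. m \<in> \<Lambda>}. sup_norm (\<Phi> \<Lambda>)))"
    by (simp add: sum_distrib_left)
  also have "\<dots> \<le> (\<Sum>m\<in>W. 2 * tail (translate (site_neg m) W))"
    using finQ by (intro sum_mono mult_left_mono sum_le_tail) (simp, use QB in \<open>auto simp: Q_def\<close>)
  also have "\<dots> = 2 * boundary W" by (simp add: boundary_def sum_distrib_left)
  finally show ?thesis .
qed

text \<open>Around a site outside the \<open>k\<close>-margin the box contains the cube of radius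
  \<open>k\<close>, so the tail there is small; in the margin the crude bound \<open>tail {}\<close>
  is enough, since the margin has density zero.\<close>

lemma boundary_density_tendsto_0:
  "(\<lambda>n. boundary (box n) / card (box n :: ('d \<Rightarrow> int) set)) \<longlonglongrightarrow> 0"
proof (rule order_tendstoI)
  fix a :: real assume "a < 0"
  moreover have "0 \<le> boundary (box n) / card (box n :: ('d \<Rightarrow> int) set)" for n
    by (simp add: boundary_nonneg)
  ultimately show "eventually (\<lambda>n. a < boundary (box n) / card (box n :: ('d \<Rightarrow> int) set)) sequentially"
    by (intro always_eventually allI) (rule less_le_trans)
next
  fix a :: real assume a: "0 < a"
  then obtain k where k: "\<And>F. {y. \<forall>i. \<bar>y i\<bar> \<le> int k} \<subseteq> F \<Longrightarrow> tail F < a / 2"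
    using tail_small[of "a / 2"] by auto
  let ?d = "\<lambda>n. card (margin n k :: ('d \<Rightarrow> int) set) / card (box n :: ('d \<Rightarrow> int) set)"
  have "(\<lambda>n. ?d n * tail {}) \<longlonglongrightarrow> 0"
    by (intro tendsto_mult_left_zero margin_density_tendsto_0)
  then have "eventually (\<lambda>n. ?d n * tail {} < a / 2) sequentially"
    using a by (intro order_tendstoD(2)) auto
  with eventually_gt_at_top[of 0]
  show "eventually (\<lambda>n. boundary (box n) / card (box n :: ('d \<Rightarrow> int) set) < a) sequentially"
  proof eventually_elim
    case (elim n)
    let ?v = "real (card (box n :: ('d \<Rightarrow> int) set))"
    have v: "?v > 0" using card_box_pos[OF elim(1)] by (simp del: of_nat_power)
    have "boundary (box n) \<le> (\<Sum>m\<in>(box n :: ('d \<Rightarrow> int) set). a / 2 + (if m \<in> margin n k then tail {} else 0))"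
      unfolding boundary_def
    proof (rule sum_mono)
      fix m :: "'d \<Rightarrow> int" assume m: "m \<in> box n"
      show "tail (translate (site_neg m) (box n)) \<le> a / 2 + (if m \<in> margin n k then tail {} else 0)"
      proof (cases "m \<in> margin n k")
        case True
        then show ?thesis using tail_antimono[of "{}" "translate (site_neg m) (box n)"] a by simp
      next
        case False
        have "{y. \<forall>i. \<bar>y i\<bar> \<le> int k} \<subseteq> translate (site_neg m) (box n)"
        proof
          fix y :: "'d \<Rightarrow> int" assume "y \<in> {y. \<forall>i. \<bar>y i\<bar> \<le> int k}"
          then have y: "\<bar>y i\<bar> \<le> int k" for i by simp
          have "int k \<le> m i \<and> m i < int n - int k" for i
            using False m by (auto simp: margin_def not_less not_le)
          then have "0 \<le> y i + m i \<and> y i + m i < int n" for i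
            using y[of i] by (smt (verit))
          then have "site_add y m \<in> box n" by (simp add: box_def site_add_def)
          then show "y \<in> translate (site_neg m) (box n)"
            by (rule image_eqI[rotated]) simp
        qed
        from k[OF this] False show ?thesis by simp
      qed
    qed
    also have "\<dots> = ?v * (a / 2) + card (margin n k :: ('d \<Rightarrow> int) set) * tail {}"
      by (simp add: sum.distrib sum.If_cases Int_absorb1 margin_def)
        (simp add: Int_def)
    finally have "boundary (box n) \<le> ?v * (a / 2) + card (margin n k :: ('d \<Rightarrow> int) set) * tail {}" .
    moreover have "B / V \<le> a / 2 + c / V * t" if "B \<le> V * (a / 2) + c * t" "V > 0" for B V c t :: real
      using that by (simp add: field_simps)
    ultimately have "boundary (box n) / ?v \<le> a / 2 + ?d n * tail {}" using v by blast
    then show ?case using elim(2) by linarith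
  qed
qed

end

section \<open>Finite-volume Gibbs measures\<close>

text \<open>At the limit zero the bound \<open>- (y * ln y) \<le> 2 * sqrt y\<close> takes over; it
  comes from \<open>ln t \<le> t - 1\<close> at \<open>t = 1 / sqrt y\<close>.\<close>

lemma tendsto_entropy_term:
  fixes f :: "'b \<Rightarrow> real"
  assumes f: "(f \<longlongrightarrow> l) F" and nonneg: "\<And>x. 0 \<le> f x" and le1: "\<And>x. f x \<le> 1"
  shows "((\<lambda>x. - (f x * ln (f x))) \<longlongrightarrow> - (l * ln l)) F"
proof (cases "l = 0")
  case False
  then show ?thesis by (intro tendsto_intros f) auto
next
  case True
  have "\<bar>- (y * ln y)\<bar> \<le> 2 * sqrt y" if y: "0 \<le> y" "y \<le> 1" for y :: real
  proof (cases "y = 0")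
    case False
    then have pos: "0 < y" using y by simp
    have "ln (1 / sqrt y) \<le> 1 / sqrt y - 1" using pos by (intro ln_le_minus_one) simp
    moreover have "ln (1 / sqrt y) = - ln y / 2" using pos by (simp add: ln_div ln_sqrt)
    ultimately have "- ln y \<le> 2 / sqrt y" by linarith
    then have "y * - ln y \<le> y * (2 / sqrt y)" using pos by (intro mult_left_mono) auto
    also have "y * (2 / sqrt y) = 2 * sqrt y"
      using pos by (simp add: field_simps)
    finally show ?thesis using ln_le_zero_of_le_one[OF y] y by (simp add: abs_mult)
  qed simp
  then have "eventually (\<lambda>x. norm (- (f x * ln (f x))) \<le> 2 * sqrt (f x)) F"
    using nonneg le1 by (intro always_eventually) auto
  moreover have "((\<lambda>x. 2 * sqrt (f x)) \<longlongrightarrow> 2 * sqrt l) F" by (intro tendsto_intros f)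
  ultimately show ?thesis using True by (auto intro: Lim_null_comparison)
qed

lemma config_prob_pmf:
  "config_prob (measure_pmf (p :: (('d::finite \<Rightarrow> int) \<Rightarrow> 'a::finite) pmf))"
  by unfold_locales auto

lemma cylinder_local_event: "finite J \<Longrightarrow> cylinder J w \<in> local_events"
  by (auto simp: local_events_def cylinder_def depends_on_def)

lemma finite_cube: "finite {y :: 'd::finite \<Rightarrow> int. \<forall>i. \<bar>y i\<bar> \<le> int k}"
proof -
  have "{y :: 'd \<Rightarrow> int. \<forall>i. \<bar>y i\<bar> \<le> int k} = PiE UNIV (\<lambda>_. {- int k..int k})"
    by (auto simp: PiE_def Pi_def abs_le_iff minus_le_iff)
  then show ?thesis by (simp add: finite_PiE)
qed

text \<open>The law of a sample of \<open>p\<close> seen from a uniformly random site of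
  \<open>S\<close>; for a large box it is almost invariant.\<close>

definition shift_average :: "('d \<Rightarrow> int) set \<Rightarrow> (('d \<Rightarrow> int) \<Rightarrow> 'a) pmf \<Rightarrow> (('d \<Rightarrow> int) \<Rightarrow> 'a) pmf" where
  "shift_average S p = bind_pmf (pmf_of_set S) (\<lambda>s. map_pmf (shift s) p)"

lemma expectation_shift_average:
  fixes f :: "(('d \<Rightarrow> int) \<Rightarrow> 'a) \<Rightarrow> real"
  assumes "finite S" "S \<noteq> {}" "finite (set_pmf p)"
  shows "measure_pmf.expectation (shift_average S p) f
    = (\<Sum>s\<in>S. measure_pmf.expectation p (\<lambda>x. f (shift s x))) / card S"
  unfolding shift_average_def using assms
  by (subst pmf_expectation_bind[where A = S])
    (auto simp: sum_distrib_left sum_divide_distrib divide_inverse mult.commute)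

lemma measure_shift_average:
  assumes "finite S" "S \<noteq> {}" "finite (set_pmf p)"
  shows "measure_pmf.prob (shift_average S p) A = (\<Sum>s\<in>S. measure_pmf.prob p (shift s -` A)) / card S"
proof -
  have eq: "(\<lambda>x. indicat_real A (shift s x)) = indicat_real (shift s -` A)" for s
    by (auto simp: indicator_def)
  have "measure_pmf.prob (shift_average S p) A = measure_pmf.expectation (shift_average S p) (indicator A)"
    by simp
  also have "\<dots> = (\<Sum>s\<in>S. measure_pmf.expectation p (\<lambda>x. indicator A (shift s x))) / card S"
    by (rule expectation_shift_average[OF assms])
  also have "\<dots> = (\<Sum>s\<in>S. measure_pmf.expectation p (indicator (shift s -` A))) / card S"
    by (simp only: eq)
  finally show ?thesis by simp
qed

text \<open>Concavity of entropy, cylinder by cylinder, since the averaged law is the mixture of the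
  shifted ones.\<close>

lemma block_entropy_shift_average:
  fixes p :: "(('d::finite \<Rightarrow> int) \<Rightarrow> 'a::finite) pmf"
  assumes S: "finite S" "S \<noteq> {}" "finite (set_pmf p)" and J: "finite J"
  shows "(\<Sum>t\<in>S. block_entropy (measure_pmf p) (translate t J)) \<le> real (card S) * block_entropy (measure_pmf (shift_average S p)) J"
proof -
  let ?a = "\<lambda>_. 1 / real (card S)"
  have pos: "real (card S) > 0" using S by (simp add: card_gt_0_iff)
  have "(\<Sum>t\<in>S. block_entropy (measure_pmf p) (translate t J)) / card S
      = (\<Sum>w\<in>blocks J. \<Sum>t\<in>S. ?a t * - (measure_pmf.prob p (shift t -` cylinder J w) * ln (measure_pmf.prob p (shift t -` cylinder J w))))"
    unfolding block_entropy_translate by (subst sum.swap) (simp add: sum_divide_distrib sum_negf)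
  also have "\<dots> \<le> block_entropy (measure_pmf (shift_average S p)) J"
    unfolding block_entropy_eq_sum_information information_def mult_minus_right
  proof (rule sum_mono)
    fix w
    have "measure_pmf.prob (shift_average S p) (cylinder J w) = (\<Sum>t\<in>S. ?a t * measure_pmf.prob p (shift t -` cylinder J w))"
      using S by (simp add: measure_shift_average sum_divide_distrib)
    then have "(\<Sum>t\<in>S. ?a t * - (measure_pmf.prob p (shift t -` cylinder J w) * ln (measure_pmf.prob p (shift t -` cylinder J w))))
      \<le> - (measure_pmf.prob (shift_average S p) (cylinder J w) * ln (measure_pmf.prob (shift_average S p) (cylinder J w)))"
      using S pos by (intro entropy_concave) auto
    then show "(\<Sum>t\<in>S. - (?a t * (measure_pmf.prob p (shift t -` cylinder J w) * ln (measure_pmf.prob p (shift t -` cylinder J w)))))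
      \<le> - (measure_pmf.prob (shift_average S p) (cylinder J w) * ln (measure_pmf.prob (shift_average S p) (cylinder J w)))"
      by simp
  qed
  finally show ?thesis using pos by (simp add: field_simps)
qed

text \<open>Shifting by \<open>t\<close> moves the averaging set from the box to its translate. The
  two set differences have the same size, at most that of a margin, and enter with opposite signs,
  so a single margin suffices.\<close>

lemma measure_shift_average_box_diff:
  fixes p :: "(('d::finite \<Rightarrow> int) \<Rightarrow> 'a) pmf"
  assumes p: "finite (set_pmf p)" and n: "n > 0" and t: "\<And>i. \<bar>t i\<bar> \<le> int k"
  shows "\<bar>measure_pmf.prob (shift_average (box n) p) (shift t -` A) - measure_pmf.prob (shift_average (box n) p) A\<bar>
    \<le> card (margin n k :: ('d \<Rightarrow> int) set) / card (box n :: ('d \<Rightarrow> int) set)"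
proof -
  let ?B = "box n :: ('d \<Rightarrow> int) set" and ?T = "translate t (box n)"
  define g where "g s = measure_pmf.prob p (shift s -` A)" for s
  have g: "0 \<le> g s" "g s \<le> 1" for s by (auto simp: g_def)
  have ne: "?B \<noteq> {}" using card_box_pos[OF n, where 'd = 'd] by auto
  have v: "shift s -` shift t -` A = shift (site_add s t) -` A" for s
    by (auto simp: shift_shift site_add_def add.commute)
  have gT: "(\<Sum>s\<in>?B. g (site_add s t)) = sum g ?T" by (simp add: sum.reindex)
  have "?B - ?T \<subseteq> margin n k"
  proof
    fix y assume y: "y \<in> ?B - ?T"
    then have "site_add y (site_neg t) \<notin> ?B" using mem_translate_iff by blast
    then obtain i where "\<not> (0 \<le> y i - t i \<and> y i - t i < int n)"
      by (auto simp: box_def site_add_def site_neg_def)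
    then have "y i < int k \<or> int n - int k \<le> y i" using t[of i] by linarith
    then show "y \<in> margin n k" using y by (auto simp: margin_def)
  qed
  then have card1: "card (?B - ?T) \<le> card (margin n k :: ('d \<Rightarrow> int) set)" by (intro card_mono) auto
  have card2: "card (?T - ?B) = card (?B - ?T)"
    by (simp add: card_Diff_subset_Int card_image Int_commute)
  have "sum g ?T = sum g (?T \<inter> ?B) + sum g (?T - ?B)" "sum g ?B = sum g (?T \<inter> ?B) + sum g (?B - ?T)"
    by (simp add: sum.Int_Diff) (metis Int_commute finite_box sum.Int_Diff)
  moreover have "sum g (?T - ?B) \<le> card (?T - ?B)" "sum g (?B - ?T) \<le> card (?B - ?T)"
    using sum_bounded_above[of "?T - ?B" g 1] sum_bounded_above[of "?B - ?T" g 1] g by auto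
  moreover have "0 \<le> sum g (?T - ?B)" "0 \<le> sum g (?B - ?T)" using g by (auto intro: sum_nonneg)
  ultimately have "\<bar>sum g ?T - sum g ?B\<bar> \<le> card (margin n k :: ('d \<Rightarrow> int) set)"
    using card1 card2 by linarith
  moreover have "measure_pmf.prob (shift_average ?B p) (shift t -` A) - measure_pmf.prob (shift_average ?B p) A
      = (sum g ?T - sum g ?B) / card ?B"
    using ne p by (simp add: measure_shift_average v g_def[symmetric] gT diff_divide_distrib)
  ultimately show ?thesis by (simp add: divide_right_mono)
qed

section \<open>Free energies against finite-volume partition functions\<close>

context summable_interaction
begin

definition partition_function :: "real \<Rightarrow> nat \<Rightarrow> real" where
  "partition_function \<beta> n = (\<Sum>w\<in>blocks (box n). exp (\<beta> * energy (box n) w))"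

lemma partition_function_pos: "0 < partition_function \<beta> n"
  unfolding partition_function_def by (intro sum_pos) (auto simp: PiE_eq_empty_iff)

lemma abs_potential_le: "\<bar>potential \<Phi> x\<bar> \<le> tail {}"
  using potential_part_approx[of "{}" x] by (simp add: potential_part_def)

text \<open>The potential is a pointwise limit of local functions, hence measurable, and it is
  bounded by \<open>tail {}\<close>. By invariance all shifted copies in
  \<open>sum_potential_approx_energy\<close> have the same integral.\<close>

lemma
  assumes \<mu>: "\<mu> \<in> invariant_measures"
  shows integrable_potential: "integrable \<mu> (potential \<Phi>)"
    and expectation_energy:
      "finite W \<Longrightarrow> \<bar>card W * integral\<^sup>L \<mu> (potential \<Phi>) - integral\<^sup>L \<mu> (energy W)\<bar> \<le> boundary W"
proof -
  interpret config_prob \<mu> using \<mu> by (rule config_prob_invariant)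
  define cube where "cube k = {y :: 'd \<Rightarrow> int. \<forall>i. \<bar>y i\<bar> \<le> int k}" for k
  have fin: "finite (cube k)" for k unfolding cube_def by (rule finite_cube)
  have lim: "(\<lambda>k. potential_part (cube k) x) \<longlonglongrightarrow> potential \<Phi> x" for x
  proof (rule LIMSEQ_I)
    fix r :: real assume "0 < r"
    then obtain k0 where k0: "\<And>F. cube k0 \<subseteq> F \<Longrightarrow> tail F < r"
      using tail_small unfolding cube_def by blast
    show "\<exists>k0. \<forall>k\<ge>k0. norm (potential_part (cube k) x - potential \<Phi> x) < r"
    proof (intro exI allI impI)
      fix k assume "k0 \<le> k"
      then have "cube k0 \<subseteq> cube k" by (auto simp: cube_def intro: order_trans)
      from k0[OF this] show "norm (potential_part (cube k) x - potential \<Phi> x) < r"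
        using potential_part_approx[OF fin[of k], of x] by (simp add: abs_minus_commute)
    qed
  qed
  have meas: "potential \<Phi> \<in> borel_measurable \<mu>"
    using lim by (rule borel_measurable_LIMSEQ_real)
      (use integrable_local[OF fin depends_on_potential_part[OF fin]] in auto)
  show int: "integrable \<mu> (potential \<Phi>)"
    using meas abs_potential_le by (intro integrable_const_bound[of _ "tail {}"]) auto
  have shift: "integrable \<mu> (\<lambda>x. potential \<Phi> (shift m x)) \<and>
      integral\<^sup>L \<mu> (\<lambda>x. potential \<Phi> (shift m x)) = integral\<^sup>L \<mu> (potential \<Phi>)" for m
  proof -
    have d: "distr \<mu> \<mu> (shift m) = \<mu>" using \<mu> by (simp add: invariant_measures_def)
    show ?thesis
      using integrable_distr_eq[OF measurable_shift_invariant[OF \<mu>, of m] meas]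
        integral_distr[OF measurable_shift_invariant[OF \<mu>, of m] meas] int by (simp add: d)
  qed
  show "\<bar>card W * integral\<^sup>L \<mu> (potential \<Phi>) - integral\<^sup>L \<mu> (energy W)\<bar> \<le> boundary W" if W: "finite W"
  proof -
    let ?f = "\<lambda>x. (\<Sum>m\<in>W. potential \<Phi> (shift m x)) - energy W x"
    have eint: "integrable \<mu> (energy W)" by (rule integrable_local[OF W depends_on_energy[OF W]])
    have fint: "integrable \<mu> ?f" using shift eint by auto
    have "card W * integral\<^sup>L \<mu> (potential \<Phi>) - integral\<^sup>L \<mu> (energy W) = integral\<^sup>L \<mu> ?f"
      using shift eint by simp
    also have "\<bar>\<dots>\<bar> \<le> (\<integral>x. \<bar>?f x\<bar> \<partial>\<mu>)" by (rule integral_abs_bound)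
    also have "\<dots> \<le> (\<integral>x. boundary W \<partial>\<mu>)"
      using fint sum_potential_approx_energy[OF W] by (intro integral_mono) auto
    also have "\<dots> = boundary W" by (simp add: prob_space)
    finally show ?thesis .
  qed
qed

lemma pressure_upper:
  assumes \<mu>: "\<mu> \<in> invariant_measures" and n: "n > 0"
  shows "card (box n :: ('d \<Rightarrow> int) set) * (ms_entropy \<mu> + \<beta> * integral\<^sup>L \<mu> (potential \<Phi>))
    \<le> block_entropy \<mu> (box n) + \<beta> * integral\<^sup>L \<mu> (energy (box n)) + \<bar>\<beta>\<bar> * boundary (box n)"
proof -
  let ?v = "real (card (box n :: ('d \<Rightarrow> int) set))"
  have v: "?v > 0" using card_box_pos[OF n] by (simp del: of_nat_power)
  have "ms_entropy \<mu> * ?v \<le> block_entropy \<mu> (box n)"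
    using ms_entropy_le[OF \<mu> n] v by (simp add: pos_le_divide_eq)
  moreover have "\<bar>\<beta> * (?v * integral\<^sup>L \<mu> (potential \<Phi>) - integral\<^sup>L \<mu> (energy (box n)))\<bar> \<le> \<bar>\<beta>\<bar> * boundary (box n)"
    using expectation_energy[OF \<mu>, of "box n"] by (simp add: abs_mult mult_left_mono)
  ultimately show ?thesis by (simp add: algebra_simps abs_le_iff)
qed

text \<open>The Gibbs distribution attains equality in \<open>gibbs_inequality\<close>.\<close>

lemma gibbs_pmf:
  obtains p :: "(('d \<Rightarrow> int) \<Rightarrow> 'a) pmf" where "finite (set_pmf p)"
    "block_entropy (measure_pmf p) (box n) + \<beta> * measure_pmf.expectation p (energy (box n)) = ln (partition_function \<beta> n)"
proof -
  let ?B = "blocks (box n) :: (('d \<Rightarrow> int) \<Rightarrow> 'a) set" and ?Z = "partition_function \<beta> n"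
  \<comment> \<open>The mass sits on blocks, which are \<open>undefined\<close> outside the box, so
    each cylinder over the box contains exactly one of them and its measure is the weight
    itself.\<close>
  define g where "g w = (if w \<in> ?B then exp (\<beta> * energy (box n) w) / ?Z else 0)" for w
  have finB: "finite ?B" by simp
  have g0: "0 \<le> g w" for w using partition_function_pos[of \<beta> n] by (auto simp: g_def)
  have sum1: "sum g ?B = 1"
    using partition_function_pos[of \<beta> n]
    by (simp add: g_def sum_divide_distrib[symmetric] partition_function_def[symmetric])
  have "(\<integral>\<^sup>+ w. ennreal (g w) \<partial>count_space UNIV) = (\<Sum>w\<in>?B. ennreal (g w))"
    by (rule nn_integral_count_space'[OF finB]) (auto simp: g_def)
  also have "\<dots> = 1" using g0 sum1 by (simp add: sum_ennreal)
  finally have nn: "(\<integral>\<^sup>+ w. ennreal (g w) \<partial>count_space UNIV) = 1" .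
  define p where "p = embed_pmf g"
  have pmf: "pmf p w = g w" for w unfolding p_def by (rule pmf_embed_pmf[OF g0 nn])
  have supp: "set_pmf p \<subseteq> ?B" using pmf by (metis g_def set_pmf_iff subsetI)
  then have fin: "finite (set_pmf p)" using finB finite_subset by blast
  interpret config_prob "measure_pmf p" by (rule config_prob_pmf)
  have cyl: "measure_pmf.prob p (cylinder (box n) w) = g w" if "w \<in> ?B" for w
  proof -
    have "measure_pmf.prob p (cylinder (box n) w) = measure_pmf.prob p (cylinder (box n) w \<inter> set_pmf p)"
      by (simp add: measure_Int_set_pmf)
    also have "cylinder (box n) w \<inter> set_pmf p = {w} \<inter> set_pmf p"
      using supp mem_cylinder_iff[OF that] by (auto simp: PiE_restrict cylinder_def)
    also have "measure_pmf.prob p \<dots> = g w"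
      by (simp add: measure_Int_set_pmf measure_pmf_single pmf)
    finally show ?thesis .
  qed
  have "block_entropy (measure_pmf p) (box n) + \<beta> * measure_pmf.expectation p (energy (box n))
      = (\<Sum>w\<in>?B. g w * - ln (g w) + \<beta> * (g w * energy (box n) w))"
    unfolding block_entropy_eq_sum_information information_def
    by (simp add: expectation_local[OF finite_box depends_on_energy] cyl sum_subtractf sum_negf sum_distrib_left)
  also have "\<dots> = (\<Sum>w\<in>?B. g w * ln ?Z)"
  proof (rule sum.cong[OF refl])
    fix w assume "w \<in> ?B"
    then have l: "ln (g w) = \<beta> * energy (box n) w - ln ?Z"
      using partition_function_pos[of \<beta> n] unfolding g_def by (simp only: if_True) (simp add: ln_div)
    show "g w * - ln (g w) + \<beta> * (g w * energy (box n) w) = g w * ln ?Z"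
      unfolding l by (simp add: algebra_simps)
  qed
  also have "\<dots> = ln ?Z" using sum1 by (simp add: sum_distrib_right[symmetric])
  finally show ?thesis using fin by (intro that[of p]) auto
qed

lemma expectation_potential_part:
  assumes "\<mu> \<in> invariant_measures" "finite K"
  shows "\<bar>integral\<^sup>L \<mu> (potential_part K) - integral\<^sup>L \<mu> (potential \<Phi>)\<bar> \<le> tail K"
proof -
  interpret config_prob \<mu> using assms(1) by (rule config_prob_invariant)
  have i: "integrable \<mu> (potential_part K)" "integrable \<mu> (potential \<Phi>)"
    using integrable_local[OF assms(2) depends_on_potential_part] integrable_potential assms by auto
  have "\<bar>integral\<^sup>L \<mu> (potential_part K) - integral\<^sup>L \<mu> (potential \<Phi>)\<bar>
      = \<bar>\<integral>x. potential_part K x - potential \<Phi> x \<partial>\<mu>\<bar>" using i by simp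
  also have "\<dots> \<le> (\<integral>x. \<bar>potential_part K x - potential \<Phi> x\<bar> \<partial>\<mu>)" by (rule integral_abs_bound)
  also have "\<dots> \<le> (\<integral>x. tail K \<partial>\<mu>)"
    using i potential_part_approx[OF assms(2)] by (intro integral_mono) (auto simp: abs_minus_commute)
  finally show ?thesis by (simp add: prob_space)
qed

text \<open>Shift averages of the finite-volume Gibbs measures, as in Misiurewicz's proof of the variational
  principle.\<close>

lemma shift_average_gibbs:
  fixes p :: "(('d \<Rightarrow> int) \<Rightarrow> 'a) pmf"
  assumes fin: "finite (set_pmf p)"
    and p: "block_entropy (measure_pmf p) (box n) + \<beta> * measure_pmf.expectation p (energy (box n))
      = ln (partition_function \<beta> n)"
    and n: "n > 0" and m: "m > 0" and K: "finite K"
  defines "\<rho> \<equiv> shift_average (box n) p"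
  shows "ln (partition_function \<beta> n) / card (box n :: ('d \<Rightarrow> int) set)
    \<le> block_entropy (measure_pmf \<rho>) (box m) / card (box m :: ('d \<Rightarrow> int) set)
      + card (margin n m :: ('d \<Rightarrow> int) set) / card (box n :: ('d \<Rightarrow> int) set) * ln CARD('a)
      + (\<beta> * measure_pmf.expectation \<rho> (potential_part K) + \<bar>\<beta>\<bar> * tail K)
      + \<bar>\<beta>\<bar> * (boundary (box n) / card (box n :: ('d \<Rightarrow> int) set))"
proof -
  interpret config_prob "measure_pmf p" by (rule config_prob_pmf)
  let ?B = "box n :: ('d \<Rightarrow> int) set"
  let ?v = "real (card ?B)" and ?u = "real (card (box m :: ('d \<Rightarrow> int) set))"
  let ?E = "measure_pmf.expectation p"
  have v: "?v > 0" "?u > 0" using card_box_pos[OF n] card_box_pos[OF m] by (simp_all del: of_nat_power)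
  then have ne: "?B \<noteq> {}" by auto
  have int [simp]: "integrable p f" for f :: "(('d \<Rightarrow> int) \<Rightarrow> 'a) \<Rightarrow> real"
    by (rule integrable_measure_pmf_finite[OF fin])
  have "?u * block_entropy (measure_pmf p) ?B \<le> (\<Sum>t\<in>?B. block_entropy (measure_pmf p) (translate t (box m)))
      + ?u * (card (margin n m :: ('d \<Rightarrow> int) set) * ln CARD('a))"
    by (rule block_entropy_grid[OF m])
  also have "(\<Sum>t\<in>?B. block_entropy (measure_pmf p) (translate t (box m))) \<le> ?v * block_entropy (measure_pmf \<rho>) (box m)"
    unfolding \<rho>_def using ne fin by (intro block_entropy_shift_average) auto
  finally have H: "block_entropy (measure_pmf p) ?B / ?v \<le> block_entropy (measure_pmf \<rho>) (box m) / ?u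
      + card (margin n m :: ('d \<Rightarrow> int) set) / ?v * ln CARD('a)"
    using v by (intro density_le_add_density) auto
  have "\<bar>?v * measure_pmf.expectation \<rho> (potential_part K) - ?E (energy ?B)\<bar>
      = \<bar>?E (\<lambda>x. (\<Sum>s\<in>?B. potential_part K (shift s x)) - energy ?B x)\<bar>"
    unfolding \<rho>_def using ne fin v by (subst expectation_shift_average) auto
  also have "\<dots> \<le> ?E (\<lambda>x. \<bar>(\<Sum>s\<in>?B. potential_part K (shift s x)) - energy ?B x\<bar>)"
    by (rule integral_abs_bound)
  also have "\<dots> \<le> ?E (\<lambda>x. ?v * tail K + boundary ?B)"
  proof (rule integral_mono)
    fix x
    have "\<bar>(\<Sum>s\<in>?B. potential_part K (shift s x)) - (\<Sum>s\<in>?B. potential \<Phi> (shift s x))\<bar> \<le> (\<Sum>s\<in>?B. tail K)"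
      unfolding sum_subtractf[symmetric]
      using potential_part_approx[OF K] by (intro order_trans[OF sum_abs] sum_mono) (simp add: abs_minus_commute)
    moreover have "\<bar>(\<Sum>s\<in>?B. potential \<Phi> (shift s x)) - energy ?B x\<bar> \<le> boundary ?B"
      by (rule sum_potential_approx_energy) simp
    ultimately show "\<bar>(\<Sum>s\<in>?B. potential_part K (shift s x)) - energy ?B x\<bar> \<le> ?v * tail K + boundary ?B"
      by simp
  qed simp_all
  also have "\<dots> = ?v * tail K + boundary ?B" by simp
  finally have "\<bar>\<beta> * (?v * measure_pmf.expectation \<rho> (potential_part K) - ?E (energy ?B))\<bar>
      \<le> \<bar>\<beta>\<bar> * (?v * tail K + boundary ?B)"
    by (simp add: abs_mult mult_left_mono)
  then have "\<beta> * ?E (energy ?B) \<le> \<beta> * (?v * measure_pmf.expectation \<rho> (potential_part K)) + \<bar>\<beta>\<bar> * (?v * tail K + boundary ?B)"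
    by (simp add: right_diff_distrib)
  then have E: "\<beta> * ?E (energy ?B) / ?v \<le> \<beta> * measure_pmf.expectation \<rho> (potential_part K) + \<bar>\<beta>\<bar> * tail K + \<bar>\<beta>\<bar> * (boundary ?B / ?v)"
  proof -
    have "X / V \<le> b * e + a * t + a * (d / V)" if "0 < V" "X \<le> b * (V * e) + a * (V * t + d)" for V X a b d e t :: real
      using that by (simp add: field_simps)
    then show ?thesis using \<open>\<beta> * ?E (energy ?B) \<le> _\<close> v by blast
  qed
  show ?thesis using H E unfolding p[symmetric] add_divide_distrib by linarith
qed

text \<open>Produces an invariant measure that is at least as good as given lower bounds on the
  partition functions. The bounds are asked for along a sequence of sides only, because the
  replacement arguments provide them for multiples \<open>n * M\<close>.\<close>

proposition pressure_attained:
  fixes c :: "nat \<Rightarrow> real"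
  assumes r: "filterlim r at_top sequentially" and c: "c \<longlonglongrightarrow> c0"
    and le: "eventually (\<lambda>k. card (box (r k) :: ('d \<Rightarrow> int) set) * c k \<le> ln (partition_function \<beta> (r k))) sequentially"
  obtains \<mu> :: "(('d \<Rightarrow> int) \<Rightarrow> 'a) measure" where "\<mu> \<in> invariant_measures"
    "c0 \<le> ms_entropy \<mu> + \<beta> * integral\<^sup>L \<mu> (potential \<Phi>)"
proof -
  have "\<exists>p. finite (set_pmf p) \<and> block_entropy (measure_pmf p) (box (r k))
      + \<beta> * measure_pmf.expectation p (energy (box (r k))) = ln (partition_function \<beta> (r k))" for k
    by (rule gibbs_pmf[of "r k" \<beta>]) blast
  then obtain p :: "nat \<Rightarrow> (('d \<Rightarrow> int) \<Rightarrow> 'a) pmf" where fin: "\<And>k. finite (set_pmf (p k))"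
    and p: "\<And>k. block_entropy (measure_pmf (p k)) (box (r k))
      + \<beta> * measure_pmf.expectation (p k) (energy (box (r k))) = ln (partition_function \<beta> (r k))"
    by metis
  define \<rho> where "\<rho> k = shift_average (box (r k)) (p k)" for k
  let ?v = "\<lambda>n. real (card (box n :: ('d \<Rightarrow> int) set))"
  let ?d = "\<lambda>m n. card (margin n m :: ('d \<Rightarrow> int) set) / ?v n"
  have rpos: "eventually (\<lambda>k. r k > 0) sequentially"
    by (rule eventually_compose_filterlim[OF eventually_gt_at_top r])
  have "(\<lambda>k. measure_pmf.prob (\<rho> k) (shift t -` A) - measure_pmf.prob (\<rho> k) A) \<longlonglongrightarrow> 0" for t A
  proof (rule Lim_null_comparison)
    define l where "l = Max (range (\<lambda>i. nat \<bar>t i\<bar>))"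
    have "nat \<bar>t i\<bar> \<le> l" for i unfolding l_def by (intro Max_ge) auto
    then have l: "\<bar>t i\<bar> \<le> int l" for i by (simp add: nat_le_iff)
    show "eventually (\<lambda>k. norm (measure_pmf.prob (\<rho> k) (shift t -` A) - measure_pmf.prob (\<rho> k) A) \<le> ?d l (r k)) sequentially"
      using rpos by eventually_elim
        (unfold \<rho>_def real_norm_def, rule measure_shift_average_box_diff[OF fin _ l])
    show "(\<lambda>k. ?d l (r k)) \<longlonglongrightarrow> 0"
      by (rule filterlim_compose[OF margin_density_tendsto_0 r])
  qed
  then obtain \<mu> F where \<mu>: "\<mu> \<in> invariant_measures" and F: "F \<noteq> bot" "F \<le> sequentially"
    and lim: "\<And>A. A \<in> local_events \<Longrightarrow> ((\<lambda>k. measure_pmf.prob (\<rho> k) A) \<longlongrightarrow> measure \<mu> A) F"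
    by (rule invariant_limit_point[of \<rho>]) blast
  interpret config_prob \<mu> using \<mu> by (rule config_prob_invariant)
  have cF: "(c \<longlongrightarrow> c0) F" using c F(2) by (rule tendsto_mono[rotated])
  have rF: "filterlim r at_top F" by (rule filterlim_mono[OF r order_refl F(2)])
  have leF: "eventually (\<lambda>k. card (box (r k) :: ('d \<Rightarrow> int) set) * c k \<le> ln (partition_function \<beta> (r k)) \<and> r k > 0) F"
    using eventually_conj[OF le rpos] F(2) by (rule filter_leD[rotated])
  \<comment> \<open>Order of limits: the volume grows along \<open>F\<close> with \<open>m\<close>
    and \<open>K\<close> fixed, as only events on fixed finite sets pass to the limit; then
    \<open>K\<close> is enlarged until its tail is negligible, and finally \<open>m\<close> tends to
    infinity.\<close>
  have bound: "c0 \<le> block_entropy \<mu> (box m) / ?v m + (\<beta> * integral\<^sup>L \<mu> (potential_part K) + \<bar>\<beta>\<bar> * tail K)"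
    if m: "m > 0" and K: "finite K" for m K
  proof (rule tendsto_le[OF F(1) _ cF])
    let ?R = "\<lambda>k. block_entropy (measure_pmf (\<rho> k)) (box m) / ?v m + ?d m (r k) * ln CARD('a)
      + (\<beta> * measure_pmf.expectation (\<rho> k) (potential_part K) + \<bar>\<beta>\<bar> * tail K) + \<bar>\<beta>\<bar> * (boundary (box (r k)) / ?v (r k))"
    have H: "((\<lambda>k. block_entropy (measure_pmf (\<rho> k)) (box m)) \<longlongrightarrow> block_entropy \<mu> (box m)) F"
      unfolding block_entropy_eq_sum_information information_def mult_minus_right
      by (intro tendsto_sum tendsto_entropy_term lim cylinder_local_event) auto
    have E: "((\<lambda>k. measure_pmf.expectation (\<rho> k) (potential_part K)) \<longlongrightarrow> integral\<^sup>L \<mu> (potential_part K)) F"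
      unfolding config_prob.expectation_local[OF config_prob_pmf K depends_on_potential_part[OF K]]
        expectation_local[OF K depends_on_potential_part[OF K]]
      using K by (intro tendsto_sum tendsto_mult_right lim cylinder_local_event) auto
    have "(?R \<longlongrightarrow> block_entropy \<mu> (box m) / ?v m + 0 * ln CARD('a)
      + (\<beta> * integral\<^sup>L \<mu> (potential_part K) + \<bar>\<beta>\<bar> * tail K) + \<bar>\<beta>\<bar> * 0) F"
      by (intro tendsto_add tendsto_mult_left tendsto_mult_right tendsto_const E
          tendsto_divide[OF H tendsto_const]
          filterlim_compose[OF margin_density_tendsto_0 rF] filterlim_compose[OF boundary_density_tendsto_0 rF])
        (use card_box_pos[OF m, where 'd = 'd] in auto)
    then show "(?R \<longlongrightarrow> block_entropy \<mu> (box m) / ?v m + (\<beta> * integral\<^sup>L \<mu> (potential_part K) + \<bar>\<beta>\<bar> * tail K)) F"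
      by simp
    show "eventually (\<lambda>k. c k \<le> ?R k) F"
      using leF
    proof eventually_elim
      case (elim k)
      have "?v (r k) > 0" using card_box_pos[of "r k"] elim by (simp del: of_nat_power)
      then have "c k \<le> ln (partition_function \<beta> (r k)) / ?v (r k)"
        using elim by (simp add: pos_le_divide_eq mult.commute)
      also have "\<dots> \<le> ?R k"
        unfolding \<rho>_def using elim by (intro shift_average_gibbs[OF fin p _ m K]) auto
      finally show ?case .
    qed
  qed
  have "c0 \<le> block_entropy \<mu> (box m) / ?v m + \<beta> * integral\<^sup>L \<mu> (potential \<Phi>)" if m: "m > 0" for m
  proof (rule field_le_epsilon)
    fix \<epsilon> :: real assume \<epsilon>: "\<epsilon> > 0"
    \<comment> \<open>The error is \<open>2 * \<bar>\<beta>\<bar> * tail K\<close>: one tail from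
      \<open>bound\<close>, one from replacing \<open>potential_part K\<close> by the potential.
      Adding 1 keeps the divisor positive when \<open>\<beta> = 0\<close>.\<close>
    define \<delta> where "\<delta> = \<epsilon> / (2 * \<bar>\<beta>\<bar> + 1)"
    have \<delta>: "\<delta> > 0" using \<epsilon> by (simp add: \<delta>_def)
    then obtain k where "tail {y. \<forall>i. \<bar>y i\<bar> \<le> int k} < \<delta>" using tail_small by blast
    then obtain K where K: "finite K" "tail K < \<delta>" using finite_cube by blast
    have "\<bar>\<beta> * (integral\<^sup>L \<mu> (potential_part K) - integral\<^sup>L \<mu> (potential \<Phi>))\<bar> \<le> \<bar>\<beta>\<bar> * tail K"
      using expectation_potential_part[OF \<mu> K(1)] by (simp add: abs_mult mult_left_mono)
    then have "c0 \<le> block_entropy \<mu> (box m) / ?v m + \<beta> * integral\<^sup>L \<mu> (potential \<Phi>) + 2 * \<bar>\<beta>\<bar> * tail K"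
      using bound[OF m K(1)] by (simp add: right_diff_distrib)
    moreover have "2 * \<bar>\<beta>\<bar> * tail K \<le> (2 * \<bar>\<beta>\<bar> + 1) * \<delta>"
      using K(2) tail_nonneg[of K] by (intro mult_mono) auto
    moreover have "(2 * \<bar>\<beta>\<bar> + 1) * \<delta> = \<epsilon>" by (simp add: \<delta>_def add_nonneg_eq_0_iff)
    ultimately show "c0 \<le> block_entropy \<mu> (box m) / ?v m + \<beta> * integral\<^sup>L \<mu> (potential \<Phi>) + \<epsilon>" by linarith
  qed
  then have "eventually (\<lambda>m. c0 \<le> block_entropy \<mu> (box m) / ?v m + \<beta> * integral\<^sup>L \<mu> (potential \<Phi>)) sequentially"
    by (intro eventually_sequentiallyI[of 1]) auto
  then have "c0 \<le> ms_entropy \<mu> + \<beta> * integral\<^sup>L \<mu> (potential \<Phi>)"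
    by (rule tendsto_lowerbound[OF tendsto_add[OF ms_entropy_tendsto[OF \<mu>] tendsto_const]]) simp
  with \<mu> show ?thesis by (rule that)
qed

end

section \<open>Replacing patterns in windows\<close>

definition scale_site :: "nat \<Rightarrow> ('d \<Rightarrow> int) \<Rightarrow> ('d \<Rightarrow> int)" where
  "scale_site n k = (\<lambda>i. int n * k i)"

definition window_of :: "nat \<Rightarrow> ('d \<Rightarrow> int) \<Rightarrow> ('d \<Rightarrow> int)" where
  "window_of n y = (\<lambda>i. y i div int n)"

text \<open>Windows are the cells of side \<open>n\<close> of the aligned grid, and \<open>S\<close>
  holds cell indices; for \<open>n > 0\<close> the pattern \<open>v\<close> is only read on
  \<open>box n\<close>.\<close>

definition replace_windows ::
    "nat \<Rightarrow> (('d \<Rightarrow> int) \<Rightarrow> 'a) \<Rightarrow> ('d \<Rightarrow> int) set \<Rightarrow> (('d \<Rightarrow> int) \<Rightarrow> 'a) \<Rightarrow> (('d \<Rightarrow> int) \<Rightarrow> 'a)" where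
  "replace_windows n v S x = (\<lambda>y. if window_of n y \<in> S then v (\<lambda>i. y i mod int n) else x y)"

text \<open>Only aligned windows count. They are pairwise disjoint, so replacing one neither creates
  nor destroys an occurrence in another.\<close>

definition occurrences ::
    "nat \<Rightarrow> nat \<Rightarrow> (('d::finite \<Rightarrow> int) \<Rightarrow> 'a) \<Rightarrow> (('d \<Rightarrow> int) \<Rightarrow> 'a) \<Rightarrow> ('d \<Rightarrow> int) set" where
  "occurrences n M u x = {k \<in> box M. shift (scale_site n k) x \<in> cylinder (box n) u}"

lemma finite_occurrences [simp]: "finite (occurrences n M u x)"
  by (simp add: occurrences_def)

lemma window_of_site_add:
  "m \<in> box n \<Longrightarrow> window_of n (site_add m (scale_site n k)) = k"
  "m \<in> box n \<Longrightarrow> (\<lambda>i. site_add m (scale_site n k) i mod int n) = m"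
  by (auto simp: window_of_def site_add_def scale_site_def box_def fun_eq_iff) (smt (verit, best) div_mult_self2 div_pos_pos_trivial)

lemma window_eq:
  assumes "n > 0"
  shows "translate (scale_site n k) (box n) = {y :: 'd::finite \<Rightarrow> int. window_of n y = k}"
proof (intro equalityI subsetI)
  fix y :: "'d \<Rightarrow> int" assume y: "y \<in> {y. window_of n y = k}"
  have "y = site_add (\<lambda>i. y i mod int n) (scale_site n (window_of n y))"
    by (simp add: site_add_def scale_site_def window_of_def)
  moreover have "(\<lambda>i. y i mod int n) \<in> box n" using assms by (simp add: box_def)
  ultimately show "y \<in> translate (scale_site n k) (box n)" using y by auto
qed (auto simp: window_of_site_add)

lemma window_of_mem_box_iff:
  assumes "n > 0"
  shows "window_of n y \<in> box M \<longleftrightarrow> (y :: 'd::finite \<Rightarrow> int) \<in> box (n * M)"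
proof -
  have "0 \<le> y i div int n \<longleftrightarrow> 0 \<le> y i" for i using assms by (simp add: pos_imp_zdiv_nonneg_iff)
  moreover have "y i div int n < int M \<longleftrightarrow> y i < int (n * M)" for i
  proof -
    have "int M \<le> y i div int n \<longleftrightarrow> int M * int n \<le> y i"
    proof
      assume "int M \<le> y i div int n"
      then have "int M * int n \<le> y i div int n * int n" by (rule mult_right_mono) simp
      also have "\<dots> \<le> y i" using assms by (simp add: minus_mod_eq_div_mult[symmetric])
      finally show "int M * int n \<le> y i" .
    next
      assume "int M * int n \<le> y i"
      then have "int M * int n div int n \<le> y i div int n" using assms by (intro zdiv_mono1) auto
      then show "int M \<le> y i div int n" using assms by simp
    qed
    then show ?thesis by (simp add: linorder_not_le[symmetric] mult.commute)
  qed
  ultimately show ?thesis by (simp add: box_def window_of_def)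
qed

lemma window_subset:
  assumes "n > 0" "k \<in> box M"
  shows "translate (scale_site n k) (box n) \<subseteq> (box (n * M) :: ('d::finite \<Rightarrow> int) set)"
  unfolding window_eq[OF assms(1)] using window_of_mem_box_iff[OF assms(1)] assms(2) by auto

lemma shift_replace_windows:
  assumes "m \<in> box n"
  shows "shift (scale_site n k) (replace_windows n v S x) m = (if k \<in> S then v m else shift (scale_site n k) x m)"
  using assms by (simp add: shift_def replace_windows_def window_of_site_add)

lemma card_box_mult: "card (box (n * M) :: ('d::finite \<Rightarrow> int) set) = card (box n :: ('d \<Rightarrow> int) set) * card (box M :: ('d \<Rightarrow> int) set)"
  by (simp add: card_box power_mult_distrib)

lemma depends_on_occurrences:
  fixes u :: "('d::finite \<Rightarrow> int) \<Rightarrow> 'a"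
  assumes "n > 0"
  shows "depends_on (box (n * M)) (occurrences n M u)"
  unfolding depends_on_def
proof (intro allI impI)
  fix x y :: "('d \<Rightarrow> int) \<Rightarrow> 'a" assume eq: "\<forall>m\<in>box (n * M). x m = y m"
  have "shift (scale_site n k) x m = shift (scale_site n k) y m" if "k \<in> box M" "m \<in> box n" for k m
    using eq window_subset[OF assms that(1)] that(2) by (auto simp: shift_def)
  then show "occurrences n M u x = occurrences n M u y"
    by (auto simp: occurrences_def cylinder_def)
qed

lemma expectation_occurrences:
  fixes \<mu> :: "(('d::finite \<Rightarrow> int) \<Rightarrow> 'a::finite) measure"
  assumes \<mu>: "\<mu> \<in> invariant_measures"
  shows "integral\<^sup>L \<mu> (\<lambda>x. card (occurrences n M u x))
    = card (box M :: ('d \<Rightarrow> int) set) * measure \<mu> (cylinder (box n) u)"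
proof -
  interpret config_prob \<mu> using \<mu> by (rule config_prob_invariant)
  let ?A = "\<lambda>k. shift (scale_site n k) -` cylinder (box n) u"
  have A: "?A k \<in> sets \<mu>" for k
    unfolding vimage_shift_cylinder by (rule cylinder_sets) simp
  have "real (card (occurrences n M u x)) = (\<Sum>k\<in>box M. indicator (?A k) x)" for x
    by (simp add: occurrences_def indicator_def sum.If_cases Int_def)
  then have "integral\<^sup>L \<mu> (\<lambda>x. card (occurrences n M u x)) = (\<Sum>k\<in>box M. prob (?A k))"
    using A by (simp add: emeasure_eq_measure space_UNIV)
  also have "\<dots> = (\<Sum>k\<in>(box M :: ('d \<Rightarrow> int) set). prob (cylinder (box n) u))"
    using \<mu> by (intro sum.cong refl measure_vimage_shift cylinder_sets) auto
  finally show ?thesis by simp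
qed

lemma sum_Pow_power_card:
  "finite A \<Longrightarrow> (\<Sum>S\<in>Pow A. q ^ card S) = (1 + q :: real) ^ card A"
  using prod_add[of A "\<lambda>_. q" "\<lambda>_. 1"] by (simp add: add.commute)

section \<open>Energies and partition functions under replacement\<close>

context summable_interaction
begin

text \<open>The gain guaranteed when one window changes from \<open>u\<close> to \<open>v\<close>,
  whatever surrounds it; the subtracted term is the error in \<open>energy_replace\<close>.\<close>

definition energy_gain :: "nat \<Rightarrow> (('d \<Rightarrow> int) \<Rightarrow> 'a) \<Rightarrow> (('d \<Rightarrow> int) \<Rightarrow> 'a) \<Rightarrow> real" where
  "energy_gain n u v = energy (box n) v - energy (box n) u - 2 * boundary (box n)"

text \<open>Windows are replaced one at a time. Window \<open>k\<close> still shows \<open>u\<close>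
  when its turn comes, because earlier replacements took place in other windows.\<close>

lemma energy_replace_windows:
  assumes n: "n > 0" and S: "S \<subseteq> occurrences n M u x"
  shows "energy (box (n * M)) x + card S * energy_gain n u v
    \<le> energy (box (n * M)) (replace_windows n v S x)"
proof -
  have "finite S" using S finite_subset by (metis finite_occurrences)
  then show ?thesis using S
  proof (induction S)
    case empty
    then show ?case by (simp add: replace_windows_def)
  next
    case (insert k S)
    let ?y = "replace_windows n v S x" and ?z = "replace_windows n v (insert k S) x"
    let ?W = "translate (scale_site n k) (box n)" and ?B = "box (n * M) :: ('d \<Rightarrow> int) set"
    have k: "k \<in> box M" "shift (scale_site n k) x \<in> cylinder (box n) u"
      using insert.prems by (auto simp: occurrences_def)
    have "\<bar>(energy ?B ?z - energy ?B ?y) - (energy ?W ?z - energy ?W ?y)\<bar> \<le> 2 * boundary ?W"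
      using window_subset[OF n k(1)]
      by (intro energy_replace) (auto simp: window_eq[OF n] replace_windows_def)
    moreover have "energy ?W ?z = energy (box n) v"
      unfolding energy_translate[OF finite_box]
      by (intro depends_onD[OF depends_on_energy]) (auto simp: shift_replace_windows)
    moreover have "energy ?W ?y = energy (box n) u"
      unfolding energy_translate[OF finite_box] using k(2) insert.hyps
      by (intro depends_onD[OF depends_on_energy]) (auto simp: shift_replace_windows cylinder_def)
    ultimately have "energy_gain n u v \<le> energy ?B ?z - energy ?B ?y"
      by (simp add: boundary_translate energy_gain_def)
    then show ?case using insert by (simp add: algebra_simps)
  qed
qed

lemma expectation_energy_occurrences:
  fixes b :: real
  assumes \<mu>: "\<mu> \<in> invariant_measures" and n: "n > 0"
  shows "integral\<^sup>L \<mu> (\<lambda>x. \<beta> * energy (box (n * M)) x + card (occurrences n M u x) * b)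
    = \<beta> * integral\<^sup>L \<mu> (energy (box (n * M))) + card (box M :: ('d \<Rightarrow> int) set) * measure \<mu> (cylinder (box n) u) * b"
proof -
  interpret config_prob \<mu> using \<mu> by (rule config_prob_invariant)
  have "integrable \<mu> (energy (box (n * M)))" "integrable \<mu> (\<lambda>x. card (occurrences n M u x) * b)"
    by (rule integrable_local[of "box (n * M)"], simp, rule depends_on_energy, simp,
        rule integrable_local[of "box (n * M)"], simp, rule depends_on_comp[OF depends_on_occurrences[OF n]])
  then show ?thesis by (simp add: expectation_occurrences[OF \<mu>] mult.assoc)
qed

text \<open>For each configuration, replacing all occurrences of \<open>u\<close> yields one block
  whose single term bounds the partition function from below. Integration turns the number of
  occurrences into its mean; the entropy of \<open>\<mu>\<close> is sacrificed.\<close>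

lemma partition_function_ge_replaced:
  assumes \<mu>: "\<mu> \<in> invariant_measures" and n: "n > 0" and \<beta>: "\<beta> \<ge> 0"
  shows "\<beta> * integral\<^sup>L \<mu> (energy (box (n * M)))
      + card (box M :: ('d \<Rightarrow> int) set) * measure \<mu> (cylinder (box n) u) * (\<beta> * energy_gain n u v)
    \<le> ln (partition_function \<beta> (n * M))"
proof -
  interpret config_prob \<mu> using \<mu> by (rule config_prob_invariant)
  let ?B = "box (n * M) :: ('d \<Rightarrow> int) set"
  let ?f = "\<lambda>x. \<beta> * energy ?B x + card (occurrences n M u x) * (\<beta> * energy_gain n u v)"
  have "?f x \<le> ln (partition_function \<beta> (n * M))" for x
  proof -
    let ?y = "replace_windows n v (occurrences n M u x) x"
    have "?f x = \<beta> * (energy ?B x + card (occurrences n M u x) * energy_gain n u v)"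
      by (simp add: algebra_simps)
    also have "\<dots> \<le> \<beta> * energy ?B ?y"
      by (intro mult_left_mono energy_replace_windows n \<beta>) simp
    also have "energy ?B ?y = energy ?B (restrict ?y ?B)"
      by (rule depends_onD[OF depends_on_energy]) auto
    also have "\<beta> * energy ?B (restrict ?y ?B) = ln (exp (\<beta> * energy ?B (restrict ?y ?B)))" by simp
    also have "\<dots> \<le> ln (partition_function \<beta> (n * M))"
      using partition_function_pos[of \<beta> "n * M"] unfolding partition_function_def
      by (subst ln_le_cancel_iff) (auto intro!: member_le_sum)
    finally show ?thesis .
  qed
  moreover have "integrable \<mu> ?f"
    by (rule integrable_local[of ?B], simp,
        rule depends_on_mono[OF depends_on_comp2[OF depends_on_energy depends_on_occurrences[OF n]]]) auto
  ultimately have "integral\<^sup>L \<mu> ?f \<le> (\<integral>x. ln (partition_function \<beta> (n * M)) \<partial>\<mu>)"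
    by (intro integral_mono) auto
  then show ?thesis
    unfolding expectation_energy_occurrences[OF \<mu> n] by (simp add: prob_space)
qed

text \<open>A pattern \<open>v\<close> of measure zero marks the replaced windows, so that distinct pairs of a typical
  configuration and a set of replaced occurrences of \<open>u\<close> give distinct configurations.\<close>

lemma partition_function_ge_marked:
  assumes \<mu>: "\<mu> \<in> invariant_measures" and n: "n > 0" and \<beta>: "\<beta> \<ge> 0"
    and v: "measure \<mu> (cylinder (box n) v) = 0"
  shows "block_entropy \<mu> (box (n * M)) + \<beta> * integral\<^sup>L \<mu> (energy (box (n * M)))
      + card (box M :: ('d \<Rightarrow> int) set) * measure \<mu> (cylinder (box n) u) * ln (1 + exp (\<beta> * energy_gain n u v))
    \<le> ln (partition_function \<beta> (n * M))"
proof -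
  interpret config_prob \<mu> using \<mu> by (rule config_prob_invariant)
  let ?B = "box (n * M) :: ('d \<Rightarrow> int) set"
  let ?p = "\<lambda>w. prob (cylinder ?B w)" and ?q = "exp (\<beta> * energy_gain n u v)"
  let ?r = "\<lambda>w. \<beta> * energy ?B w + card (occurrences n M u w) * ln (1 + ?q)"
  \<comment> \<open>The typical blocks; as \<open>v\<close> has measure zero, none of them shows it
    in an aligned window.\<close>
  define I where "I = {w \<in> blocks ?B. ?p w \<noteq> 0}"
  have finI: "finite I" by (simp add: I_def)
  have no_v: "occurrences n M v w = {}" if "w \<in> I" for w
  proof (rule ccontr)
    assume "occurrences n M v w \<noteq> {}"
    then obtain k where k: "k \<in> occurrences n M v w" by blast
    have "cylinder ?B w \<subseteq> shift (scale_site n k) -` cylinder (box n) v"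
    proof
      fix x assume "x \<in> cylinder ?B w"
      then have "occurrences n M v x = occurrences n M v w"
        by (intro depends_onD[OF depends_on_occurrences[OF n]]) (simp add: cylinder_def)
      with k show "x \<in> shift (scale_site n k) -` cylinder (box n) v" by (auto simp: occurrences_def)
    qed
    then have "?p w \<le> prob (shift (scale_site n k) -` cylinder (box n) v)"
      by (rule finite_measure_mono) (simp add: vimage_shift_cylinder cylinder_sets)
    also have "\<dots> = 0" using \<mu> v by (simp add: measure_vimage_shift cylinder_sets)
    finally show False using that measure_nonneg[of \<mu> "cylinder ?B w"] by (simp add: I_def)
  qed
  let ?D = "SIGMA w:I. Pow (occurrences n M u w)"
  let ?T = "\<lambda>(w, S). replace_windows n v S w"
  have inj: "inj_on ?T ?D"
  \<comment> \<open>Since \<open>v\<close> did not occur before, the windows showing it afterwards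
    are exactly those of \<open>S\<close>, and each of them showed \<open>u\<close>; so the pair can
    be read off.\<close>
  proof (rule inj_on_inverseI[where g = "\<lambda>y. (replace_windows n u (occurrences n M v y) y, occurrences n M v y)"])
    fix a assume "a \<in> ?D"
    then obtain w S where a: "a = (w, S)" and w: "w \<in> I" and S: "S \<subseteq> occurrences n M u w" by auto
    let ?y = "replace_windows n v S w"
    have "k \<in> occurrences n M v ?y \<longleftrightarrow> k \<in> S" for k
    proof (cases "k \<in> S")
      case True
      then have "k \<in> box M" using S by (auto simp: occurrences_def)
      with True show ?thesis by (auto simp: occurrences_def cylinder_def shift_replace_windows)
    next
      case False
      then have "k \<in> occurrences n M v ?y \<longleftrightarrow> k \<in> occurrences n M v w"
        by (auto simp: occurrences_def cylinder_def shift_replace_windows)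
      with no_v[OF w] False show ?thesis by simp
    qed
    then have occ: "occurrences n M v ?y = S" by blast
    have "replace_windows n u S ?y z = w z" for z
    proof (cases "window_of n z \<in> S")
      case True
      then have "z \<in> translate (scale_site n (window_of n z)) (box n)" by (simp add: window_eq[OF n])
      then obtain m where m: "m \<in> box n" "z = site_add m (scale_site n (window_of n z))" by auto
      have "shift (scale_site n (window_of n z)) w \<in> cylinder (box n) u"
        using True S by (auto simp: occurrences_def)
      then have "w (site_add m (scale_site n (window_of n z))) = u m"
        using m(1) by (simp add: cylinder_def shift_def)
      moreover have "(\<lambda>i. z i mod int n) = m" using m by (metis window_of_site_add(2))
      ultimately show ?thesis using True m(2) by (simp add: replace_windows_def)
    qed (simp add: replace_windows_def)
    then have "replace_windows n u S ?y = w" by blast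
    then show "(replace_windows n u (occurrences n M v (?T a)) (?T a), occurrences n M v (?T a)) = a"
      by (simp add: a occ)
  qed
  have img: "?T ` ?D \<subseteq> blocks ?B"
  proof
    fix y assume "y \<in> ?T ` ?D"
    then obtain w S where y: "y = replace_windows n v S w" and w: "w \<in> I" and S: "S \<subseteq> occurrences n M u w" by auto
    have "y z = undefined" if "z \<notin> ?B" for z
    proof -
      have "window_of n z \<notin> S" using that S window_of_mem_box_iff[OF n] by (auto simp: occurrences_def)
      then have "y z = w z" by (simp add: y replace_windows_def)
      also have "\<dots> = undefined" using w that by (auto simp: I_def PiE_def extensional_def)
      finally show ?thesis .
    qed
    then show "y \<in> blocks ?B" by (auto simp: PiE_def extensional_def)
  qed
  \<comment> \<open>Each occurrence is either kept, with weight 1, or replaced, with weight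
    \<open>?q\<close>; summing over subsets gives the power of \<open>1 + ?q\<close>. The true
    weight of the replaced block is at least the corresponding product.\<close>
  have "(\<Sum>w\<in>I. exp (?r w)) = (\<Sum>w\<in>I. \<Sum>S\<in>Pow (occurrences n M u w). exp (\<beta> * energy ?B w) * ?q ^ card S)"
  proof (rule sum.cong[OF refl])
    fix w assume "w \<in> I"
    have "exp (card (occurrences n M u w) * ln (1 + ?q)) = (1 + ?q) ^ card (occurrences n M u w)"
      by (simp add: exp_of_nat_mult add_pos_pos)
    then show "exp (?r w) = (\<Sum>S\<in>Pow (occurrences n M u w). exp (\<beta> * energy ?B w) * ?q ^ card S)"
      by (simp add: exp_add sum_distrib_left[symmetric] sum_Pow_power_card)
  qed
  also have "\<dots> \<le> (\<Sum>w\<in>I. \<Sum>S\<in>Pow (occurrences n M u w). exp (\<beta> * energy ?B (replace_windows n v S w)))"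
  proof (intro sum_mono)
    fix w S assume "S \<in> Pow (occurrences n M u w)"
    then have "\<beta> * (energy ?B w + card S * energy_gain n u v) \<le> \<beta> * energy ?B (replace_windows n v S w)"
      by (intro mult_left_mono energy_replace_windows n \<beta>) simp
    then have "exp (\<beta> * energy ?B w + card S * (\<beta> * energy_gain n u v)) \<le> exp (\<beta> * energy ?B (replace_windows n v S w))"
      by (simp add: algebra_simps)
    then show "exp (\<beta> * energy ?B w) * ?q ^ card S \<le> exp (\<beta> * energy ?B (replace_windows n v S w))"
      by (simp add: exp_add exp_of_nat_mult)
  qed
  also have "\<dots> = (\<Sum>a\<in>?D. exp (\<beta> * energy ?B (?T a)))"
    using finI by (subst sum.Sigma) (auto simp: case_prod_unfold)
  also have "\<dots> = (\<Sum>y\<in>?T ` ?D. exp (\<beta> * energy ?B y))"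
    using inj by (simp add: sum.reindex)
  also have "\<dots> \<le> partition_function \<beta> (n * M)"
    unfolding partition_function_def using img by (intro sum_mono2) auto
  finally have Z: "(\<Sum>w\<in>I. exp (?r w)) \<le> partition_function \<beta> (n * M)" .
  have sumI: "(\<Sum>w\<in>I. ?p w * h w) = (\<Sum>w\<in>blocks ?B. ?p w * h w)" for h
    by (intro sum.mono_neutral_left) (auto simp: I_def)
  have sum1: "sum ?p I = 1" using sumI[of "\<lambda>_. 1"] by (simp add: sum_prob_cylinders)
  then have "I \<noteq> {}" by auto
  then have pos: "0 < (\<Sum>w\<in>I. exp (?r w))" using finI by (intro sum_pos) auto
  \<comment> \<open>Gibbs' inequality for \<open>\<mu>\<close> against these enlarged weights keeps
    both the block entropy and the surplus from the replacements.\<close>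
  have "(\<Sum>w\<in>I. - (?p w * ln (?p w))) + (\<Sum>w\<in>I. ?p w * ?r w) \<le> ln (\<Sum>w\<in>I. exp (?r w))"
    by (rule gibbs_inequality[OF finI _ sum1]) simp
  also have "\<dots> \<le> ln (partition_function \<beta> (n * M))"
    using Z pos by simp
  also have "(\<Sum>w\<in>I. - (?p w * ln (?p w))) = block_entropy \<mu> ?B"
    using sumI[of "\<lambda>w. - ln (?p w)"] by (simp add: block_entropy_eq_sum_information information_def)
  also have "(\<Sum>w\<in>I. ?p w * ?r w) = integral\<^sup>L \<mu> ?r"
    unfolding sumI by (rule expectation_local[symmetric], simp,
        rule depends_on_mono[OF depends_on_comp2[OF depends_on_energy depends_on_occurrences[OF n]]]) auto
  finally show ?thesis unfolding expectation_energy_occurrences[OF \<mu> n] by (simp add: add.assoc)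
qed

end

section \<open>Equilibrium states\<close>

context summable_interaction
begin

abbreviation free_energy :: "real \<Rightarrow> (('d \<Rightarrow> int) \<Rightarrow> 'a) measure \<Rightarrow> real" where
  "free_energy \<beta> \<mu> \<equiv> ms_entropy \<mu> + \<beta> * integral\<^sup>L \<mu> (potential \<Phi>)"

lemma equilibrium_states_iff:
  "\<mu> \<in> equilibrium_states (\<lambda>x. \<beta> * potential \<Phi> x) \<longleftrightarrow>
    \<mu> \<in> invariant_measures \<and> (\<forall>\<nu>\<in>invariant_measures. free_energy \<beta> \<nu> \<le> free_energy \<beta> \<mu>)"
  by (simp add: equilibrium_states_def)

text \<open>By Gibbs' inequality the volume times the supremum of the free energies is at most
  \<open>ln (partition_function \<beta> n)\<close> plus a boundary term;
  \<open>pressure_attained\<close> then yields a measure reaching the supremum.\<close>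

lemma equilibrium_states_nonempty: "equilibrium_states (\<lambda>x. \<beta> * potential \<Phi> x) \<noteq> {}"
proof -
  let ?I = "invariant_measures :: (('d \<Rightarrow> int) \<Rightarrow> 'a) measure set"
  let ?v = "\<lambda>n. real (card (box n :: ('d \<Rightarrow> int) set))"
  let ?bd = "\<lambda>n. boundary (box n) / ?v n"
  have v: "?v n > 0" if "n > 0" for n using card_box_pos[OF that] by (simp del: of_nat_power)
  \<comment> \<open>At \<open>\<beta> = 0\<close> the lower bound is trivial, and the construction
    shows that some invariant measure exists, so that the supremum below is over a nonempty
    set.\<close>
  have "1 \<le> partition_function 0 n" for n
    by (simp add: partition_function_def Suc_le_eq card_gt_0_iff PiE_eq_empty_iff)
  then have "0 \<le> ln (partition_function 0 n)" for n by simp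
  then have ne: "?I \<noteq> {}"
    using pressure_attained[OF filterlim_ident tendsto_const[of 0], where \<beta> = 0] by auto
  have upper: "free_energy \<beta> \<nu> \<le> (ln (partition_function \<beta> n) + \<bar>\<beta>\<bar> * boundary (box n)) / ?v n"
    if "\<nu> \<in> ?I" "n > 0" for \<nu> n
  proof -
    interpret config_prob \<nu> using that(1) by (rule config_prob_invariant)
    have b: "depends_on (box n) (\<lambda>x. \<beta> * energy (box n) x)"
      by (rule depends_on_comp[OF depends_on_energy]) simp
    have "block_entropy \<nu> (box n) + \<beta> * integral\<^sup>L \<nu> (energy (box n)) \<le> ln (partition_function \<beta> n)"
      using block_entropy_gibbs[OF finite_box b] by (simp add: partition_function_def)
    then show ?thesis
      using pressure_upper[OF that, of \<beta>] v[OF that(2)] by (simp add: pos_le_divide_eq mult.commute)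
  qed
  define c0 where "c0 = (SUP \<nu>\<in>?I. free_energy \<beta> \<nu>)"
  have "bdd_above (free_energy \<beta> ` ?I)" using upper[of _ 1] by (intro bdd_aboveI2) auto
  then have c0: "free_energy \<beta> \<nu> \<le> c0" if "\<nu> \<in> ?I" for \<nu>
    unfolding c0_def using that by (intro cSUP_upper)
  have "eventually (\<lambda>n. ?v n * (c0 - \<bar>\<beta>\<bar> * ?bd n) \<le> ln (partition_function \<beta> n)) sequentially"
    using eventually_gt_at_top[of 0]
  proof eventually_elim
    case (elim n)
    have "c0 \<le> (ln (partition_function \<beta> n) + \<bar>\<beta>\<bar> * boundary (box n)) / ?v n"
      unfolding c0_def using ne upper elim by (intro cSUP_least) auto
    moreover have "V * (c - b * (d / V)) \<le> z" if "c \<le> (z + b * d) / V" "V > 0" for V c b d z :: real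
    proof -
      have "V * (c - b * (d / V)) = V * c - b * d" using that(2) by (simp add: right_diff_distrib)
      moreover have "V * c \<le> z + b * d" using that by (simp add: pos_le_divide_eq mult.commute)
      ultimately show ?thesis by linarith
    qed
    ultimately show ?case using v[OF elim] by blast
  qed
  moreover have "(\<lambda>n. c0 - \<bar>\<beta>\<bar> * ?bd n) \<longlonglongrightarrow> c0 - \<bar>\<beta>\<bar> * 0"
    by (intro tendsto_diff tendsto_mult_left tendsto_const boundary_density_tendsto_0)
  ultimately obtain \<mu> where "\<mu> \<in> ?I" "c0 \<le> free_energy \<beta> \<mu>"
    using pressure_attained[OF filterlim_ident, of "\<lambda>n. c0 - \<bar>\<beta>\<bar> * ?bd n" c0 \<beta>] by auto
  then have "\<mu> \<in> equilibrium_states (\<lambda>x. \<beta> * potential \<Phi> x)"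
    unfolding equilibrium_states_iff using c0 by (auto intro: order_trans)
  then show ?thesis by blast
qed

text \<open>A bound of \<open>c\<close> per window gives a competitor whose free energy per site is
  at least \<open>c / card (box n)\<close>, and an equilibrium state does no worse. The boundary
  error is negligible as \<open>M\<close> grows.\<close>

lemma equilibrium_lower_bound:
  fixes c :: real
  assumes \<mu>: "\<mu> \<in> equilibrium_states (\<lambda>x. \<beta> * potential \<Phi> x)" and n: "n > 0"
    and le: "\<And>M. M > 0 \<Longrightarrow> card (box M :: ('d \<Rightarrow> int) set) * c - \<bar>\<beta>\<bar> * boundary (box (n * M))
      \<le> ln (partition_function \<beta> (n * M))"
  shows "c / card (box n :: ('d \<Rightarrow> int) set) \<le> free_energy \<beta> \<mu>"
proof -
  let ?v = "\<lambda>n. real (card (box n :: ('d \<Rightarrow> int) set))"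
  have v: "?v m > 0" if "m > 0" for m using card_box_pos[OF that] by (simp del: of_nat_power)
  let ?c = "\<lambda>M. c / ?v n - \<bar>\<beta>\<bar> * (boundary (box (n * M)) / ?v (n * M))"
  have r: "filterlim (\<lambda>M. n * M) at_top sequentially"
    using n by (intro filterlim_subseq) (auto simp: strict_mono_def)
  have "?c \<longlonglongrightarrow> c / ?v n - \<bar>\<beta>\<bar> * 0"
    by (intro tendsto_diff tendsto_mult_left tendsto_const filterlim_compose[OF boundary_density_tendsto_0 r])
  then have lim: "?c \<longlonglongrightarrow> c / ?v n" by simp
  have ev: "eventually (\<lambda>M. ?v (n * M) * ?c M \<le> ln (partition_function \<beta> (n * M))) sequentially"
    using eventually_gt_at_top[of 0]
  proof eventually_elim
    case (elim M)
    have "V * W * (c / V - b * (d / (V * W))) = W * c - b * d" if "V > 0" "W > 0" for V W b d :: real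
      using that by (simp add: field_simps)
    then show ?case using le[OF elim] v[OF n] v[OF elim] by (simp add: card_box_mult)
  qed
  obtain \<nu> where "\<nu> \<in> invariant_measures" "c / ?v n \<le> free_energy \<beta> \<nu>"
    by (rule pressure_attained[OF r lim ev])
  then show ?thesis using \<mu> unfolding equilibrium_states_iff by (blast intro: order_trans)
qed

text \<open>If \<open>v\<close> were null, \<open>partition_function_ge_marked\<close> would give a
  competitor beating \<open>\<mu>\<close> by a fixed amount per window.\<close>

lemma equilibrium_full_support:
  assumes \<mu>: "\<mu> \<in> equilibrium_states (\<lambda>x. \<beta> * potential \<Phi> x)" and \<beta>: "\<beta> \<ge> 0" and n: "n > 0"
  shows "measure \<mu> (cylinder (box n) v) > 0"
proof (rule ccontr)
  let ?v = "\<lambda>n. real (card (box n :: ('d \<Rightarrow> int) set))"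
  have v: "?v m > 0" if "m > 0" for m using card_box_pos[OF that] by (simp del: of_nat_power)
  have inv: "\<mu> \<in> invariant_measures" using \<mu> by (simp add: equilibrium_states_iff)
  interpret config_prob \<mu> using inv by (rule config_prob_invariant)
  assume "\<not> 0 < prob (cylinder (box n) v)"
  then have v0: "prob (cylinder (box n) v) = 0" using measure_nonneg[of \<mu> "cylinder (box n) v"] by linarith
  have "\<exists>u\<in>blocks (box n). prob (cylinder (box n) u) \<noteq> 0"
    using sum_prob_cylinders[of "box n"] sum.neutral[of "blocks (box n)" "\<lambda>u. prob (cylinder (box n) u)"] by fastforce
  then obtain u where u: "prob (cylinder (box n) u) > 0"
    using measure_nonneg[of \<mu>] by (metis less_le)
  \<comment> \<open>The logarithm measures the freedom to keep or replace an occurrence; it is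
    positive even when replacement is very costly.\<close>
  define g where "g = prob (cylinder (box n) u) * ln (1 + exp (\<beta> * energy_gain n u v))"
  have g: "g > 0" unfolding g_def using u by (intro mult_pos_pos) (auto intro: ln_gt_zero)
  have "(?v n * free_energy \<beta> \<mu> + g) / ?v n \<le> free_energy \<beta> \<mu>"
  proof (rule equilibrium_lower_bound[OF \<mu> n])
    fix M :: nat assume M: "M > 0"
    have "?v (n * M) * free_energy \<beta> \<mu> \<le> block_entropy \<mu> (box (n * M))
        + \<beta> * integral\<^sup>L \<mu> (energy (box (n * M))) + \<bar>\<beta>\<bar> * boundary (box (n * M))"
      using n M by (intro pressure_upper[OF inv]) simp
    moreover have "block_entropy \<mu> (box (n * M)) + \<beta> * integral\<^sup>L \<mu> (energy (box (n * M))) + ?v M * g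
        \<le> ln (partition_function \<beta> (n * M))"
      using partition_function_ge_marked[OF inv n \<beta> v0, of M u] by (simp add: g_def mult.assoc)
    ultimately show "?v M * (?v n * free_energy \<beta> \<mu> + g) - \<bar>\<beta>\<bar> * boundary (box (n * M))
        \<le> ln (partition_function \<beta> (n * M))"
      by (simp add: card_box_mult algebra_simps)
  qed
  moreover have "(?v n * free_energy \<beta> \<mu> + g) / ?v n = free_energy \<beta> \<mu> + g / ?v n"
    using less_imp_neq[OF v[OF n]] unfolding add_divide_distrib by (subst nonzero_mult_div_cancel_left) simp_all
  moreover have "g / ?v n > 0" using g v[OF n] by simp
  ultimately show False by linarith
qed

text \<open>In the unmarked comparison the potential of \<open>\<mu>\<close> stands on both sides
  and cancels; what remains on the right is the entropy given up.\<close>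

lemma equilibrium_energy_gain_le:
  assumes \<mu>: "\<mu> \<in> equilibrium_states (\<lambda>x. \<beta> * potential \<Phi> x)" and \<beta>: "\<beta> \<ge> 0" and n: "n > 0"
  shows "\<beta> * (measure \<mu> (cylinder (box n) u) * energy_gain n u v) \<le> card (box n :: ('d \<Rightarrow> int) set) * ms_entropy \<mu>"
proof -
  let ?v = "\<lambda>n. real (card (box n :: ('d \<Rightarrow> int) set))"
  let ?i = "integral\<^sup>L \<mu> (potential \<Phi>)" and ?g = "measure \<mu> (cylinder (box n) u) * (\<beta> * energy_gain n u v)"
  have v: "?v n > 0" using card_box_pos[OF n] by (simp del: of_nat_power)
  have inv: "\<mu> \<in> invariant_measures" using \<mu> by (simp add: equilibrium_states_iff)
  have "(?v n * (\<beta> * ?i) + ?g) / ?v n \<le> free_energy \<beta> \<mu>"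
  proof (rule equilibrium_lower_bound[OF \<mu> n])
    fix M :: nat
    have "\<bar>\<beta> * (?v (n * M) * ?i - integral\<^sup>L \<mu> (energy (box (n * M))))\<bar> \<le> \<bar>\<beta>\<bar> * boundary (box (n * M))"
      using expectation_energy[OF inv, of "box (n * M)"] by (simp add: abs_mult mult_left_mono)
    then have "?v M * (?v n * (\<beta> * ?i)) - \<bar>\<beta>\<bar> * boundary (box (n * M)) \<le> \<beta> * integral\<^sup>L \<mu> (energy (box (n * M)))"
      by (simp add: card_box_mult abs_le_iff algebra_simps)
    moreover have "\<beta> * integral\<^sup>L \<mu> (energy (box (n * M))) + ?v M * ?g \<le> ln (partition_function \<beta> (n * M))"
      using partition_function_ge_replaced[OF inv n \<beta>, of M u v] by (simp add: mult.assoc)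
    ultimately show "?v M * (?v n * (\<beta> * ?i) + ?g) - \<bar>\<beta>\<bar> * boundary (box (n * M)) \<le> ln (partition_function \<beta> (n * M))"
      by (simp add: algebra_simps)
  qed
  then have "?v n * (\<beta> * ?i) + ?g \<le> ?v n * free_energy \<beta> \<mu>"
    using v by (simp add: pos_divide_le_eq mult.commute)
  then show ?thesis by (simp add: algebra_simps)
qed

text \<open>In \<open>equilibrium_energy_gain_le\<close> the right side is independent of
  \<open>\<beta>\<close> and the left is linear in it. By full support a positive gain has a
  positive coefficient, which fails for large \<open>\<beta>\<close>.\<close>

lemma energy_gain_nonpos:
  assumes "\<And>\<beta>. \<beta> > \<beta>c \<Longrightarrow> \<mu> \<in> equilibrium_states (\<lambda>x. \<beta> * potential \<Phi> x)" and n: "n > 0"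
  shows "energy_gain n u v \<le> 0"
proof (rule ccontr)
  assume "\<not> energy_gain n u v \<le> 0"
  then have pos: "energy_gain n u v > 0" by simp
  define b0 where "b0 = max \<beta>c 0 + 1"
  have "b0 > \<beta>c" "b0 \<ge> 0" by (auto simp: b0_def)
  then have "measure \<mu> (cylinder (box n) u) > 0"
    using equilibrium_full_support[of \<mu> b0 n u] assms by blast
  then have g: "measure \<mu> (cylinder (box n) u) * energy_gain n u v > 0" using pos by simp
  obtain k :: nat where "card (box n :: ('d \<Rightarrow> int) set) * ms_entropy \<mu> < k * (measure \<mu> (cylinder (box n) u) * energy_gain n u v)"
    using reals_Archimedean3[OF g] by blast
  also have "\<dots> \<le> (b0 + k) * (measure \<mu> (cylinder (box n) u) * energy_gain n u v)"
    using g \<open>b0 \<ge> 0\<close> by (intro mult_right_mono) auto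
  also have "\<dots> \<le> card (box n :: ('d \<Rightarrow> int) set) * ms_entropy \<mu>"
    using \<open>b0 > \<beta>c\<close> \<open>b0 \<ge> 0\<close> n by (intro equilibrium_energy_gain_le assms(1)) auto
  finally show False by simp
qed

lemma integral_potential_le:
  assumes gain: "\<And>n u v. n > 0 \<Longrightarrow> energy_gain n u v \<le> 0"
    and \<mu>: "\<mu> \<in> invariant_measures" and \<nu>: "\<nu> \<in> invariant_measures"
  shows "integral\<^sup>L \<mu> (potential \<Phi>) \<le> integral\<^sup>L \<nu> (potential \<Phi>)"
proof -
  let ?v = "\<lambda>n. real (card (box n :: ('d \<Rightarrow> int) set))"
  interpret M: config_prob \<mu> using \<mu> by (rule config_prob_invariant)
  interpret N: config_prob \<nu> using \<nu> by (rule config_prob_invariant)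
  \<comment> \<open>The 4 is made up of 2 from comparing energies and 1 for each measure when
    passing between energy and potential.\<close>
  have le: "integral\<^sup>L \<mu> (potential \<Phi>) - integral\<^sup>L \<nu> (potential \<Phi>) \<le> 4 * (boundary (box n) / ?v n)" if n: "n > 0" for n
  proof -
    let ?e = "energy (box n)" and ?x = "undefined :: ('d \<Rightarrow> int) \<Rightarrow> 'a"
    have v: "?v n > 0" using card_box_pos[OF n] by (simp del: of_nat_power)
    have int: "integrable \<mu> ?e" "integrable \<nu> ?e"
      using M.integrable_local[OF finite_box depends_on_energy] N.integrable_local[OF finite_box depends_on_energy] by auto
    have "?e x \<le> ?e y + 2 * boundary (box n)" for x y
      using gain[OF n, of y x] by (simp add: energy_gain_def)
    then have "integral\<^sup>L \<mu> ?e \<le> (\<integral>x. ?e y + 2 * boundary (box n) \<partial>\<mu>)" for y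
      using int by (intro integral_mono) auto
    then have "integral\<^sup>L \<mu> ?e \<le> ?e y + 2 * boundary (box n)" for y
      by (simp add: M.prob_space)
    then have "integral\<^sup>L \<mu> ?e - 2 * boundary (box n) \<le> ?e y" for y
      by (simp add: diff_le_eq)
    then have "(\<integral>y. integral\<^sup>L \<mu> ?e - 2 * boundary (box n) \<partial>\<nu>) \<le> integral\<^sup>L \<nu> ?e"
      using int by (intro integral_mono) auto
    then have "integral\<^sup>L \<mu> ?e - 2 * boundary (box n) \<le> integral\<^sup>L \<nu> ?e" by (simp add: N.prob_space)
    then have "?v n * integral\<^sup>L \<mu> (potential \<Phi>) - ?v n * integral\<^sup>L \<nu> (potential \<Phi>) \<le> 4 * boundary (box n)"
      using expectation_energy[OF \<mu>, of "box n"] expectation_energy[OF \<nu>, of "box n"] by (simp add: abs_le_iff)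
    moreover have "a - b \<le> 4 * (c / V)" if "V > 0" "V * a - V * b \<le> 4 * c" for V a b c :: real
      using that by (simp add: field_simps)
    ultimately show ?thesis using v by blast
  qed
  have "(\<lambda>n. 4 * (boundary (box n) / ?v n)) \<longlonglongrightarrow> 4 * 0"
    by (intro tendsto_mult_left boundary_density_tendsto_0)
  then have "integral\<^sup>L \<mu> (potential \<Phi>) - integral\<^sup>L \<nu> (potential \<Phi>) \<le> 4 * 0"
    by (rule tendsto_lowerbound) (use le in \<open>auto intro: eventually_sequentiallyI[of 1]\<close>)
  then show ?thesis by simp
qed

text \<open>The first clause of freezing provides \<open>\<mu>\<close> and thereby a constant
  integral of the potential. Free energies are then ordered by entropy alone, so at every
  \<open>\<beta>\<close>, on both sides of \<open>\<beta>c\<close>, the equilibrium states are the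
  measures of maximal entropy, against the second clause.\<close>

lemma no_freezing: "\<not> freezing_phase_transition (potential \<Phi>)"
proof
  assume "freezing_phase_transition (potential \<Phi>)"
  then obtain \<beta>c where
    same: "\<And>\<beta> \<beta>'. \<beta> > \<beta>c \<Longrightarrow> \<beta>' > \<beta>c \<Longrightarrow>
      equilibrium_states (\<lambda>x. \<beta> * potential \<Phi> x) = equilibrium_states (\<lambda>x. \<beta>' * potential \<Phi> x)"
    and diff: "equilibrium_states (\<lambda>x. (\<beta>c - 1) * potential \<Phi> x) \<noteq> equilibrium_states (\<lambda>x. (\<beta>c + 1) * potential \<Phi> x)"
    unfolding freezing_phase_transition_def by (metis less_add_one minus_less_iff diff_less_eq)
  obtain \<mu> where "\<mu> \<in> equilibrium_states (\<lambda>x. (\<beta>c + 1) * potential \<Phi> x)"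
    using equilibrium_states_nonempty by blast
  then have "\<mu> \<in> equilibrium_states (\<lambda>x. \<beta> * potential \<Phi> x)" if "\<beta> > \<beta>c" for \<beta>
    using same[OF that, of "\<beta>c + 1"] by simp
  then have gain: "energy_gain n u v \<le> 0" if "n > 0" for n u v
    using that by (rule energy_gain_nonpos)
  have const: "integral\<^sup>L \<mu> (potential \<Phi>) = integral\<^sup>L \<nu> (potential \<Phi>)"
    if "\<mu> \<in> invariant_measures" "\<nu> \<in> invariant_measures" for \<mu> \<nu>
    using integral_potential_le[OF gain] that by (intro antisym) auto
  have "\<mu> \<in> equilibrium_states (\<lambda>x. \<beta> * potential \<Phi> x) \<longleftrightarrow>
      \<mu> \<in> invariant_measures \<and> (\<forall>\<nu>\<in>(invariant_measures :: (('d \<Rightarrow> int) \<Rightarrow> 'a) measure set).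
        ms_entropy \<nu> \<le> ms_entropy \<mu>)" for \<beta> \<mu>
  proof -
    have "free_energy \<beta> \<nu> \<le> free_energy \<beta> \<mu> \<longleftrightarrow> ms_entropy \<nu> \<le> ms_entropy \<mu>"
      if "\<mu> \<in> invariant_measures" "\<nu> \<in> invariant_measures" for \<nu>
      using const[OF that] by simp
    then show ?thesis unfolding equilibrium_states_iff by blast
  qed
  then show False using diff by blast
qed

end

theorem theoremB:
  fixes \<Phi> :: "('d::finite \<Rightarrow> int) set \<Rightarrow> (('d \<Rightarrow> int) \<Rightarrow> 'a::finite) \<Rightarrow> real"
  assumes "is_interaction \<Phi>"
    and "(\<lambda>\<Lambda>. sup_norm (\<Phi> \<Lambda>)) summable_on {\<Lambda>. finite \<Lambda> \<and> origin \<in> \<Lambda>}"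
  shows "\<not> freezing_phase_transition (potential \<Phi>)"
proof -
  interpret summable_interaction \<Phi> using assms by unfold_locales
  show ?thesis by (rule no_freezing)
qed

end
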